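(* For every $n\ge1$, the number $\widetilde P_n$ of pairs $(T,s)$ such that $T$ is a rooted tree with vertex set $[n]$ and $s\in[n]^n$ is a prime parking distribution on $T$ equals \[ \widetilde P_n=(n-1)!\,S_{n-1}, \] where $(S_i)_{i\ge0}=1,2,6,22,90,\dots$ are the large Schröder numbers, with ordinary generating function $\sum_{i\ge0}S_ix^i=\frac{1-x-\sqrt{1-6x+x^2}}{2x}$.
   Context: Let $T$ be a rooted tree with vertex set $[n]$, edges oriented towards the root (labeled, unordered; all such trees are counted). For $s\in[n]^n$, drivers $1,\dots,n$ arrive in order; driver $i$ parks at $s_i$ if unoccupied, otherwise follows the directed path towards the root and parks at the first unoccupied vertex, leaving if none exists. $(T,s)$ is a parking function if all drivers park. For a vertex $v$, $T_v$ is the set of vertices $u$ with a directed path from $u$ to $v$ (including $v$). A parking function $(T,s)$ is prime if $|T_v|<|\{i:s_i\in T_v\}|$ for every non-root vertex $v$. A parking distribution is a parking function $(T,s)$ in which $s$ is weakly increasing ($s_1\le s_2\le\dots\le s_n$); a prime parking distribution is a parking distribution which is prime. *)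

theory Defs
  imports "HOL-Library.FuncSet"
begin

text \<open>A rooted tree on vertex set [n] = {1..n}, edges oriented towards the root, is encoded
  by its parent map p: every non-root vertex v has the edge v -> p v; the root r is the
  unique vertex with p r = r, and every vertex reaches r by iterating p.
  p is extensional (undefined outside {1..n}), so trees correspond bijectively to such maps.\<close>
definition rooted_tree :: "nat \<Rightarrow> (nat \<Rightarrow> nat) \<Rightarrow> bool" where
  "rooted_tree n p \<longleftrightarrow> p \<in> {1..n} \<rightarrow>\<^sub>E {1..n} \<and>
     (\<exists>r\<in>{1..n}. p r = r \<and> (\<forall>v\<in>{1..n}. \<exists>k. (p ^^ k) v = r))"

text \<open>First unoccupied vertex on the directed path from v to the root (the path is
  v, p v, p (p v), ..., and stays at the root forever afterwards); None if all are occupied.\<close>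
definition spot :: "(nat \<Rightarrow> nat) \<Rightarrow> nat set \<Rightarrow> nat \<Rightarrow> nat option" where
  "spot p Occ v = (if \<exists>k. (p ^^ k) v \<notin> Occ
                    then Some ((p ^^ (LEAST k. (p ^^ k) v \<notin> Occ)) v) else None)"

fun park :: "(nat \<Rightarrow> nat) \<Rightarrow> nat set \<Rightarrow> nat list \<Rightarrow> nat set option" where
  "park p Occ [] = Some Occ"
| "park p Occ (x # xs) = (case spot p Occ x of None \<Rightarrow> None
                          | Some u \<Rightarrow> park p (insert u Occ) xs)"

text \<open>s in [n]^n is a list of length n with entries in {1..n}; s ! (i-1) is s_i.\<close>
definition parking_function :: "nat \<Rightarrow> (nat \<Rightarrow> nat) \<Rightarrow> nat list \<Rightarrow> bool" where
  "parking_function n p s \<longleftrightarrow> rooted_tree n p \<and> length s = n \<and> set s \<subseteq> {1..n} \<and>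
     park p {} s \<noteq> None"

definition subtree :: "nat \<Rightarrow> (nat \<Rightarrow> nat) \<Rightarrow> nat \<Rightarrow> nat set" where
  "subtree n p v = {u \<in> {1..n}. \<exists>k. (p ^^ k) u = v}"

definition prime_parking_function :: "nat \<Rightarrow> (nat \<Rightarrow> nat) \<Rightarrow> nat list \<Rightarrow> bool" where
  "prime_parking_function n p s \<longleftrightarrow> parking_function n p s \<and>
     (\<forall>v\<in>{1..n}. p v \<noteq> v \<longrightarrow>
        card (subtree n p v) < card {i. i < n \<and> s ! i \<in> subtree n p v})"

definition parking_distribution :: "nat \<Rightarrow> (nat \<Rightarrow> nat) \<Rightarrow> nat list \<Rightarrow> bool" where
  "parking_distribution n p s \<longleftrightarrow> parking_function n p s \<and> sorted s"

definition prime_parking_distribution :: "nat \<Rightarrow> (nat \<Rightarrow> nat) \<Rightarrow> nat list \<Rightarrow> bool" where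
  "prime_parking_distribution n p s \<longleftrightarrow> parking_distribution n p s \<and> prime_parking_function n p s"

text \<open>Large Schroeder numbers 1,2,6,22,90,...: S_0 = 1, S_(m+1) = S_m + sum_(k=0..m) S_k S_(m-k);
  this is equivalent to the ogf (1 - x - sqrt(1-6x+x^2))/(2x).\<close>
fun schroeder :: "nat \<Rightarrow> nat" where
  "schroeder 0 = 1"
| "schroeder (Suc m) = schroeder m + (\<Sum>k\<le>m. schroeder k * schroeder (m - k))"

lemma "map schroeder [0,1,2,3,4] = [1,2,6,22,90]"
  by (simp add: numeral_eq_Suc)

end

(* Let e(v) be the number of drivers preferring a vertex of T_v minus |T_v|, which is the number of
   drivers that leave T_v.  For a prime
   parking distribution e is at least 1 at every non-root vertex, it is 0 at the root, and the
   number of drivers preferring v is e(v) + 1 - (sum of e over the children of v).  So the pairs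
   (T, s) correspond to the pairs (T, e) where e satisfies these local constraints and the children
   of v have total excess at most e(v) + 1.

   Let F(x, y) be the series of trees with root excess at least 1, exponential in the size and
   ordinary in the root excess, and F0(x) that of the trees with root excess 0.  Removing
   the root gives y (1 - y) (F + F0) = x (exp F - 1 + y), and the kernel method along the curve
   2 Y^2 - (1 + x) Y + x = 0 yields F0' = 1/x - 1/Y = S, the series of the large Schroeder
   numbers.  The exponential E = exp F is handled through E_x = F_x E, which is the
   decomposition of a forest at the component of a distinguished vertex. *)
theory Submission
  imports Defs "HOL-Computational_Algebra.Formal_Power_Series" "HOL-Library.Multiset"
begin

unbundle fps_syntax

section \<open>Bivariate formal power series\<close>

text \<open>Bivariate series are power series in the outer variable \<open>x\<close> with coefficients
  that are power series in the inner variable \<open>y\<close>.\<close>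
definition fps_diag :: "'a::comm_ring_1 fps fps \<Rightarrow> 'a fps" where
  "fps_diag B = Abs_fps (\<lambda>N. \<Sum>n\<le>N. B $ n $ (N - n))"

text \<open>\<open>fps_diag\<close> is the substitution y = x, hence multiplicative.\<close>

lemma fps_diag_mult: "fps_diag (B * C) = fps_diag B * fps_diag C"
proof (rule fps_ext)
  fix N
  have "fps_diag (B * C) $ N
      = (\<Sum>n\<le>N. \<Sum>i\<le>n. \<Sum>j\<le>N - n. B $ i $ j * C $ (n - i) $ (N - n - j))"
    by (simp add: fps_diag_def fps_mult_nth fps_sum_nth atLeast0AtMost)
  also have "\<dots> = (\<Sum>(n, i, j)\<in>(SIGMA n:{..N}. {..n} \<times> {..N - n}).
                    B $ i $ j * C $ (n - i) $ (N - n - j))"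
    by (simp add: sum.Sigma sum.cartesian_product)
  also have "\<dots> = (\<Sum>(M, i, k)\<in>(SIGMA M:{..N}. {..M} \<times> {..N - M}).
                    B $ i $ (M - i) * C $ k $ (N - M - k))"
    \<comment> \<open>Here M = i + j is the total degree taken from \<open>B\<close>, and k = n - i
      is the outer degree taken from \<open>C\<close>.\<close>
    by (rule sum.reindex_bij_witness[where
          i = "\<lambda>(M, i, k). (i + k, i, M - i)" and j = "\<lambda>(n, i, j). (i + j, i, n - i)"])
      (auto simp: algebra_simps)
  also have "\<dots> = (\<Sum>M\<le>N. \<Sum>i\<le>M. \<Sum>k\<le>N - M. B $ i $ (M - i) * C $ k $ (N - M - k))"
    by (simp add: sum.Sigma sum.cartesian_product)
  also have "\<dots> = (fps_diag B * fps_diag C) $ N"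
    by (simp add: fps_diag_def fps_mult_nth atLeast0AtMost sum_product)
  finally show "fps_diag (B * C) $ N = (fps_diag B * fps_diag C) $ N" .
qed

text \<open>This is B(x, Y(x)): each coefficient is composed with \<open>Y\<close> in the inner
  variable, which \<open>fps_diag\<close> then identifies with the outer one.\<close>

definition fps_eval_inner :: "'a::idom fps \<Rightarrow> 'a fps fps \<Rightarrow> 'a fps" where
  "fps_eval_inner Y B = fps_diag (Abs_fps (\<lambda>n. B $ n oo Y))"

lemma fps_eval_inner_add: "fps_eval_inner Y (B + C) = fps_eval_inner Y B + fps_eval_inner Y C"
  by (simp add: fps_eval_inner_def fps_diag_def fps_compose_add_distrib sum.distrib fps_eq_iff)

lemma fps_eval_inner_diff: "fps_eval_inner Y (B - C) = fps_eval_inner Y B - fps_eval_inner Y C"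
  by (simp add: fps_eval_inner_def fps_diag_def fps_compose_sub_distrib sum_subtractf fps_eq_iff)

lemma fps_eval_inner_mult:
  assumes "Y $ 0 = 0"
  shows "fps_eval_inner Y (B * C) = fps_eval_inner Y B * fps_eval_inner Y C"
proof -
  have "Abs_fps (\<lambda>n. (B * C) $ n oo Y) = Abs_fps (\<lambda>n. B $ n oo Y) * Abs_fps (\<lambda>n. C $ n oo Y)"
    by (rule fps_ext)
       (simp add: fps_mult_nth fps_compose_sum_distrib fps_compose_mult_distrib[OF assms])
  then show ?thesis
    by (simp add: fps_eval_inner_def fps_diag_mult)
qed

lemma fps_eval_inner_const: "fps_eval_inner Y (fps_const c) = c oo Y"
proof (rule fps_ext)
  fix N
  have "fps_eval_inner Y (fps_const c) $ N = (\<Sum>n\<le>N. if n = 0 then (c oo Y) $ N else 0)"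
    unfolding fps_eval_inner_def fps_diag_def fps_nth_Abs_fps by (intro sum.cong) auto
  then show "fps_eval_inner Y (fps_const c) $ N = (c oo Y) $ N" by simp
qed

text \<open>Embeds series in x as constants in y. Series in y are embedded by
  \<open>fps_const\<close>, so y itself is \<open>fps_const fps_X\<close>.\<close>

definition fps_outer :: "'a::comm_ring_1 fps \<Rightarrow> 'a fps fps" where
  "fps_outer f = Abs_fps (\<lambda>n. fps_const (f $ n))"

lemma fps_outer_nth [simp]: "fps_outer f $ n = fps_const (f $ n)"
  by (simp add: fps_outer_def)

lemma fps_eval_inner_outer: "fps_eval_inner Y (fps_outer f) = f"
proof (rule fps_ext)
  fix N
  have "fps_eval_inner Y (fps_outer f) $ N = (\<Sum>n\<le>N. if n = N then f $ N else 0)"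
    unfolding fps_eval_inner_def fps_diag_def by (auto intro!: sum.cong)
  then show "fps_eval_inner Y (fps_outer f) $ N = f $ N" by simp
qed

lemma fps_outer_X: "fps_outer fps_X = fps_X"
  by (simp add: fps_eq_iff fps_X_def)

lemma fps_deriv_outer: "fps_deriv (fps_outer f) = fps_outer (fps_deriv f)"
  by (simp add: fps_eq_iff algebra_simps flip: fps_of_nat)

section \<open>Differentiation in the inner variable\<close>

definition fps_deriv_inner :: "'a::comm_ring_1 fps fps \<Rightarrow> 'a fps fps" where
  "fps_deriv_inner B = Abs_fps (\<lambda>n. fps_deriv (B $ n))"

lemma fps_deriv_inner_nth [simp]: "fps_deriv_inner B $ n = fps_deriv (B $ n)"
  by (simp add: fps_deriv_inner_def)

lemma fps_deriv_inner_add: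
  "fps_deriv_inner (B + C) = fps_deriv_inner B + fps_deriv_inner C"
  by (simp add: fps_eq_iff algebra_simps)

lemma fps_deriv_inner_diff:
  "fps_deriv_inner (B - C) = fps_deriv_inner B - fps_deriv_inner C"
  by (simp add: fps_eq_iff algebra_simps)

lemma fps_deriv_inner_mult:
  "fps_deriv_inner (B * C) = B * fps_deriv_inner C + fps_deriv_inner B * C"
  by (rule fps_ext) (simp add: fps_mult_nth fps_deriv_sum sum.distrib)

lemma fps_deriv_inner_outer [simp]: "fps_deriv_inner (fps_outer f) = 0"
  by (rule fps_ext) simp

lemma fps_deriv_inner_const [simp]: "fps_deriv_inner (fps_const c) = fps_const (fps_deriv c)"
  by (rule fps_ext) simp

lemma fps_deriv_deriv_inner: "fps_deriv (fps_deriv_inner B) = fps_deriv_inner (fps_deriv B)"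
  by (rule fps_ext) simp

text \<open>The equation expresses each coefficient of \<open>D\<close> through lower ones;
  characteristic 0 allows division by \<open>Suc m\<close>.\<close>

lemma fps_linear_ODE_zero:
  fixes D :: "'a::{idom,ring_char_0} fps fps"
  assumes "fps_deriv D = P * D" "D $ 0 = 0"
  shows "D = 0"
proof (rule fps_ext)
  fix n show "D $ n = 0 $ n"
  proof (induction n rule: less_induct)
    case (less n)
    show ?case
    proof (cases n)
      case (Suc m)
      have "of_nat (Suc m) * D $ Suc m = (P * D) $ m"
        by (simp flip: assms(1))
      also have "\<dots> = 0"
        using less Suc by (auto simp: fps_mult_nth intro!: sum.neutral)
      finally have "fps_const (of_nat (Suc m)) * D $ Suc m = 0"
        by (simp only: fps_of_nat)
      then show ?thesis using Suc by (simp del: of_nat_Suc)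
    qed (use assms in simp)
  qed
qed

text \<open>\<open>E\<close> plays the role of exp F but is known only through its x-derivative.
  Since the partial derivatives commute, the defect D = E_y - F_y E solves D_x = F_x D with value 0
  at x = 0.\<close>

lemma fps_inner_log_deriv:
  fixes E F :: "real fps fps"
  assumes "fps_deriv E = fps_deriv F * E" "E $ 0 = 1" "F $ 0 = 0"
  shows "fps_deriv_inner E = fps_deriv_inner F * E"
proof -
  define D where "D = fps_deriv_inner E - fps_deriv_inner F * E"
  have "fps_deriv D = fps_deriv_inner (fps_deriv F * E)
      - (fps_deriv_inner F * (fps_deriv F * E) + fps_deriv_inner (fps_deriv F) * E)"
    by (simp add: D_def fps_deriv_deriv_inner assms(1))
  also have "\<dots> = fps_deriv F * D"
    by (simp add: D_def fps_deriv_inner_mult algebra_simps)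
  finally have "fps_deriv D = fps_deriv F * D" .
  moreover have "D $ 0 = 0" by (simp add: D_def assms)
  ultimately have "D = 0" by (rule fps_linear_ODE_zero)
  then show ?thesis by (simp add: D_def)
qed

section \<open>The functional equation with a catalytic variable\<close>

definition schroeder_fps :: "real fps" where
  "schroeder_fps = Abs_fps (\<lambda>n. real (schroeder n))"

lemma schroeder_fps_eq:
  "schroeder_fps = 1 + fps_X * schroeder_fps * (schroeder_fps + 1)"
proof (rule fps_ext)
  fix n show "schroeder_fps $ n = (1 + fps_X * schroeder_fps * (schroeder_fps + 1)) $ n"
    unfolding mult.assoc fps_add_nth fps_X_mult_nth
    by (cases n)
       (simp_all add: schroeder_fps_def distrib_left fps_mult_nth atLeast0AtMost)
qed

text \<open>Along the curve \<open>y = Y x\<close> with \<open>Y = x (S x + 1) / 2\<close>, a root of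
  \<open>2 Y\<^sup>2 - (1 + x) Y + x = 0\<close>, the equation and its \<open>y\<close>-derivative give
  \<open>((1 - 2 Y) g - x) (1 - 2 Y - a (1 - Y) Y) = 0\<close> for the value \<open>g\<close> of \<open>F + f0\<close> and some
  series \<open>a\<close>. The second factor has constant term 1, so the first one vanishes.\<close>
lemma catalytic_solution:
  fixes E F :: "real fps fps" and f0 :: "real fps"
  defines "x \<equiv> fps_X" and "y \<equiv> fps_const fps_X"
  assumes log_deriv: "fps_deriv E = fps_deriv F * E" and E0: "E $ 0 = 1" and F0: "F $ 0 = 0"
    and func: "y * (1 - y) * (F + fps_outer f0) = x * (E - 1 + y)"
  shows "fps_deriv f0 = schroeder_fps"
proof -
  define S where "S = schroeder_fps"
  define X :: "real fps" where "X = fps_X"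
  define Y where "Y = fps_const (1/2) * X * (S + 1)"
  define ev where "ev = fps_eval_inner Y"
  have S: "S = 1 + X * S * (S + 1)"
    unfolding S_def X_def by (rule schroeder_fps_eq)
  have "2 * Y = fps_const (2 * (1/2)) * X * (S + 1)"
    unfolding Y_def numeral_fps_const mult.assoc[symmetric] fps_const_mult by simp
  then have Y2: "2 * Y = X * (S + 1)" by simp
  have Y0: "Y $ 0 = 0" by (simp add: Y_def X_def)
  have ev_mult: "ev (B * C) = ev B * ev C" for B C
    unfolding ev_def by (rule fps_eval_inner_mult[OF Y0])
  have ev_const: "ev (fps_const c) = c oo Y" for c
    by (simp add: ev_def fps_eval_inner_const)
  have ev_x: "ev x = X"
    using fps_eval_inner_outer[of Y fps_X] by (simp add: fps_outer_X ev_def x_def X_def)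
  have ev_y: "ev y = Y" by (simp add: y_def ev_const Y0)
  have ev_1: "ev 1 = 1" using ev_const[of 1] by simp
  have ev_2: "ev 2 = 2" using ev_const[of 2] by (simp add: numeral_fps_const)
  note ev_simps = ev_mult fps_eval_inner_add[of Y, folded ev_def]
    fps_eval_inner_diff[of Y, folded ev_def] ev_x ev_y ev_1 ev_2
    fps_eval_inner_outer[of Y, folded ev_def]
  \<comment> \<open>After evaluation at y = Y only algebra on univariate series remains:
    \<open>a\<close>, \<open>b\<close>, \<open>g\<close>, \<open>w\<close> are the values of F_y,
    F_x, F + f0 and E.\<close>
  define a b g w f where "a = ev (fps_deriv_inner F)" and "b = ev (fps_deriv F)"
    and "g = ev (F + fps_outer f0)" and "w = ev E" and "f = fps_deriv f0"
  have one: "fps_deriv_inner (1 :: real fps fps) = 0"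
    using fps_deriv_inner_const[of "1 :: real fps"] by simp
  have dx: "fps_deriv_inner x = 0" using fps_deriv_inner_outer[of fps_X] by (simp add: fps_outer_X x_def)
  have dy: "fps_deriv_inner y = 1" by (simp add: y_def)
  have 1: "Y * (1 - Y) * g = X * (w - 1 + Y)"
    using arg_cong[OF func, of ev] by (simp add: ev_simps g_def w_def)
  \<comment> \<open>The y-derivative of \<open>func\<close>, with E_y replaced by F_y E.\<close>
  have "(1 - 2 * y) * (F + fps_outer f0) + y * (1 - y) * fps_deriv_inner F
      = x * (fps_deriv_inner F * E + 1)"
    using arg_cong[OF func, of fps_deriv_inner]
    by (simp add: fps_deriv_inner_mult fps_deriv_inner_add fps_deriv_inner_diff dx dy one
        fps_inner_log_deriv[OF log_deriv E0 F0] algebra_simps)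
  from arg_cong[OF this, of ev]
  have 2: "(1 - 2 * Y) * g + Y * (1 - Y) * a = X * (a * w + 1)"
    by (simp add: ev_simps a_def w_def g_def)
  \<comment> \<open>The x-derivative of \<open>func\<close> brings in the derivative of
    \<open>f0\<close>.\<close>
  have "y * (1 - y) * (fps_deriv F + fps_outer (fps_deriv f0))
      = (E - 1 + y) + x * (fps_deriv F * E)"
    using arg_cong[OF func, of fps_deriv]
    by (simp add: log_deriv fps_deriv_outer x_def y_def algebra_simps)
  from arg_cong[OF this, of ev]
  have 3: "Y * (1 - Y) * (b + f) = (w - 1 + Y) + X * (b * w)"
    by (simp add: ev_simps b_def w_def f_def)
  have "2 * (2 * Y * Y - (1 + X) * Y + X) = (2*Y) * (2*Y) - (1 + X) * (2*Y) + 2 * X"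
    by (simp add: algebra_simps)
  also have "\<dots> = X * (1 + X * S * (S + 1) - S)"
    unfolding Y2 by (simp add: algebra_simps)
  also have "\<dots> = 0" using S by simp
  finally have 4: "2 * Y * Y - (1 + X) * Y + X = 0" unfolding mult_eq_0_iff by simp
  define t where "t = (1 - 2 * Y) * g - X"
  have nz: "1 - 2 * Y \<noteq> 0" "1 - Y \<noteq> 0" "1 - 2 * Y - a * (1 - Y) * Y \<noteq> 0"
    by (auto simp: fps_eq_iff Y0 intro!: exI[of _ 0])
  \<comment> \<open>Eliminating \<open>w\<close> from 1 and 2 expresses \<open>t\<close> by Y g + X
    - Y. By the equation 4 of the curve this quantity is itself Y t / (1 - 2 Y), so \<open>t\<close>
    becomes a factor.\<close>
  have "X * w = (1 - Y) * (Y * g + X)" using 1 by algebra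
  moreover from this have "t = a * (1 - Y) * (Y * g + X - Y)" using 2 unfolding t_def by algebra
  moreover have 5: "(1 - 2 * Y) * (Y * g + X - Y) = Y * t" using 4 unfolding t_def by algebra
  ultimately have "t * (1 - 2 * Y - a * (1 - Y) * Y) = 0" by algebra
  then have "t = 0" using nz by simp
  with 5 nz have Yg: "Y * g + X - Y = 0" by simp
  have Xw: "X * w = (1 - Y) * Y" using 1 Yg by algebra
  \<comment> \<open>Inserting \<open>Xw\<close> into 3 cancels the terms in the unknown
    \<open>b\<close>, leaving f = 1/X - 1/Y.\<close>
  have "(1 - Y) * (X * Y * f - (Y - X)) = 0" using 3 Xw by algebra
  then have "X * Y * f = Y - X" using nz by simp
  then have "X * X * (S + 1) * (f - S) = 0" using Y2 S by algebra
  moreover have "X \<noteq> 0" by (simp add: X_def)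
  moreover have "(S + 1) $ 0 \<noteq> 0" by (simp add: S_def schroeder_fps_def)
  then have "S + 1 \<noteq> 0" by (metis fps_zero_nth)
  ultimately show ?thesis by (simp add: f_def S_def)
qed

section \<open>Numerical recursions for forests and trees\<close>

text \<open>The recursion removes the tree of a distinguished vertex; it has \<open>j + 1\<close> vertices and
  root excess \<open>k\<close>.\<close>
fun forest_count :: "nat \<Rightarrow> nat \<Rightarrow> nat" where
  "forest_count 0 m = (if m = 0 then 1 else 0)"
| "forest_count (Suc n) m = (\<Sum>j\<le>n. (n choose j) * (\<Sum>k=1..m.
     (Suc j * (\<Sum>i\<le>Suc k. forest_count j i)) * forest_count (n - j) (m - k)))"

text \<open>There are n choices for the root; the other vertices form a forest whose root excesses
  total at most k + 1.\<close>

definition tree_count :: "nat \<Rightarrow> nat \<Rightarrow> nat" where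
  "tree_count n k = n * (\<Sum>i\<le>Suc k. forest_count (n - 1) i)"

text \<open>\<open>forest_count\<close> has this factor written out because
  \<open>tree_count\<close> is defined from it in turn.\<close>

lemma forest_count_Suc:
  "forest_count (Suc n) m = (\<Sum>j\<le>n. (n choose j) *
     (\<Sum>k=1..m. tree_count (Suc j) k * forest_count (n - j) (m - k)))"
  by (simp add: tree_count_def)

declare forest_count.simps(2) [simp del]

lemma forest_count_Suc_0: "forest_count (Suc n) 0 = 0"
  by (simp add: forest_count_Suc)

text \<open>Partial sums amount to division by 1 - y and the index shift to division by y. The
  correction arises at k = 0, where the sum has the two terms h 0 + h 1. This is the source of the
  kernel y (1 - y).\<close>

lemma telescoping_fps:
  fixes h :: "nat \<Rightarrow> real"
  shows "fps_X * (1 - fps_X) * Abs_fps (\<lambda>k. \<Sum>i\<le>Suc k. h i)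
       = Abs_fps h - fps_const (h 0) * (1 - fps_X)"
proof (rule fps_ext)
  fix n
  let ?C = "Abs_fps (\<lambda>k. \<Sum>i\<le>Suc k. h i)"
  have "fps_X * (1 - fps_X) * ?C = fps_X * (?C - fps_X * ?C)" by (simp add: algebra_simps)
  also have "\<dots> $ n = (Abs_fps h - fps_const (h 0) * (1 - fps_X)) $ n"
    by (cases n; cases "n - 1") auto
  finally show "(fps_X * (1 - fps_X) * ?C) $ n = (Abs_fps h - fps_const (h 0) * (1 - fps_X)) $ n" .
qed

text \<open>Trees of a forest have positive root excess, so \<open>F\<close> omits k = 0. Removing a
  root treats every k alike, so the functional equation has F + f0 on its left.\<close>

lemma tree_count_0: "tree_count (Suc n) 0 = fact n * schroeder n"
proof -
  define F E :: "real fps fps" where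
    "F = Abs_fps (\<lambda>n. Abs_fps (\<lambda>k. if k = 0 then 0 else real (tree_count n k) / fact n))"
    and "E = Abs_fps (\<lambda>n. Abs_fps (\<lambda>m. real (forest_count n m) / fact n))"
  define f0 :: "real fps" where "f0 = Abs_fps (\<lambda>n. real (tree_count n 0) / fact n)"
  have F0: "F $ 0 = 0" by (simp add: F_def fps_eq_iff tree_count_def)
  have E0: "E $ 0 = 1" by (simp add: E_def fps_eq_iff)
  \<comment> \<open>This is \<open>forest_count_Suc\<close> divided by n!, the binomial coefficient
    being absorbed by the exponential scaling.\<close>
  have "fps_deriv E = fps_deriv F * E"
  proof (rule fps_ext, rule fps_ext)
    fix n m
    have scale: "real (Suc j) * (c / fact (Suc j)) = c / fact j" for c :: real and j
      by (simp add: divide_simps)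
    have dE: "fps_deriv E $ n $ m = real (forest_count (Suc n) m) / fact n"
      using scale[of n "real (forest_count (Suc n) m)"]
      by (simp add: E_def fps_mult_left_const_nth flip: fps_of_nat del: fact_Suc of_nat_Suc)
    have dF: "fps_deriv F $ j $ k = (if k = 0 then 0 else real (tree_count (Suc j) k) / fact j)" for j k
      using scale[of j "real (tree_count (Suc j) k)"]
      by (simp add: F_def fps_mult_left_const_nth flip: fps_of_nat del: fact_Suc of_nat_Suc)
    have "(fps_deriv F * E) $ n $ m
        = (\<Sum>j\<le>n. \<Sum>k\<le>m. fps_deriv F $ j $ k * E $ (n - j) $ (m - k))"
      by (simp add: fps_mult_nth fps_sum_nth atLeast0AtMost del: fps_deriv_nth)
    also have "\<dots> = (\<Sum>j\<le>n. \<Sum>k=1..m. real (tree_count (Suc j) k) / fact j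
                     * (real (forest_count (n - j) (m - k)) / fact (n - j)))"
      unfolding dF by (intro sum.cong refl sum.mono_neutral_cong_right) (auto simp: E_def)
    also have "\<dots> = real (forest_count (Suc n) m) / fact n"
      by (auto simp: forest_count_Suc sum_distrib_left sum_divide_distrib binomial_fact
          field_simps intro!: sum.cong)
    finally show "fps_deriv E $ n $ m = (fps_deriv F * E) $ n $ m" using dE by simp
  qed
  moreover have "fps_const fps_X * (1 - fps_const fps_X) * (F + fps_outer f0)
      = fps_X * (E - 1 + fps_const fps_X)"
  proof (rule fps_ext)
    fix n
    let ?y = "fps_X :: real fps"
    have c: "fps_const ?y * (1 - fps_const ?y) = fps_const (?y * (1 - ?y))"
      using fps_const_sub[of 1 ?y] by (simp del: fps_const_sub)
    have "(fps_const ?y * (1 - fps_const ?y) * (F + fps_outer f0)) $ n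
        = ?y * (1 - ?y) * Abs_fps (\<lambda>k. real (tree_count n k) / fact n)"
    proof -
      have "(F + fps_outer f0) $ n = Abs_fps (\<lambda>k. real (tree_count n k) / fact n)"
        by (auto simp: fps_eq_iff F_def f0_def)
      then show ?thesis unfolding c by (simp only: fps_mult_left_const_nth)
    qed
    also have "\<dots> = (fps_X * (E - 1 + fps_const ?y)) $ n"
    proof (cases n)
      case 0
      then show ?thesis by (simp add: tree_count_def fps_eq_iff[where ?'a = real] flip: fps_zero_def)
    next
      case (Suc m)
      have 1: "Abs_fps (\<lambda>k. real (tree_count n k) / fact n)
          = Abs_fps (\<lambda>k. \<Sum>i\<le>Suc k. real (forest_count m i) / fact m)"
        unfolding Suc
        by (rule fps_ext)
           (simp add: tree_count_def del: sum.atMost_Suc mult_Suc of_nat_Suc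
            flip: sum_divide_distrib of_nat_sum)
      \<comment> \<open>The correction h 0 = \<open>forest_count m 0\<close> is nonzero only for m =
        0, the empty forest; there it produces the summand -1 + y.\<close>
      show ?thesis
        unfolding 1 telescoping_fps using Suc
        by (cases m) (simp_all add: forest_count_Suc_0 E_def)
    qed
    finally show "(fps_const ?y * (1 - fps_const ?y) * (F + fps_outer f0)) $ n
      = (fps_X * (E - 1 + fps_const ?y)) $ n" .
  qed
  ultimately have "fps_deriv f0 $ n = schroeder_fps $ n"
    using catalytic_solution E0 F0 by metis
  then have "real (Suc n) * (real (tree_count (Suc n) 0) / fact (Suc n)) = real (schroeder n)"
    by (simp add: f0_def schroeder_fps_def del: fact_Suc)
  then have "real (tree_count (Suc n) 0) = real (fact n * schroeder n)"
    by (simp add: divide_simps del: of_nat_Suc)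
  then show ?thesis by (simp only: of_nat_eq_iff)
qed

section \<open>Rooted forests with excess labels\<close>

text \<open>An inductive form of reachability by iterates of \<open>p\<close>, giving induction
  along the path from \<open>v\<close> up to \<open>r\<close>.\<close>

inductive leads_to :: "('a \<Rightarrow> 'a) \<Rightarrow> 'a \<Rightarrow> 'a \<Rightarrow> bool" for p r where
  here: "leads_to p r r"
| step: "leads_to p r (p v) \<Longrightarrow> leads_to p r v"

lemma leads_to_parent:
  assumes "leads_to p r v" "p r = r"
  shows "leads_to p r (p v)"
  using assms by (metis leads_to.simps)

lemma leads_to_in:
  assumes "leads_to p r v" "v \<in> V" "p \<in> V \<rightarrow> V"
  shows "r \<in> V"
  using assms by (induction rule: leads_to.induct) auto

text \<open>Fixed points are absorbing, so a path cannot reach two of them.\<close>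

lemma leads_to_root_unique:
  assumes "leads_to p r v" "p r = r" "leads_to p r' v" "p r' = r'"
  shows "r = r'"
  using assms
proof (induction rule: leads_to.induct)
  case here
  from here(2) here show ?case
  proof (induction rule: leads_to.induct)
    case (step v)
    then show ?case by (metis leads_to.intros leads_to_parent)
  qed simp
next
  case (step v)
  then show ?case by (meson leads_to_parent)
qed

lemma leads_to_cong:
  assumes "leads_to p r v" "v \<in> V" "\<And>u. u \<in> V \<Longrightarrow> p u \<in> V" "\<And>u. u \<in> V \<Longrightarrow> q u = p u"
  shows "leads_to q r v"
  using assms
proof (induction rule: leads_to.induct)
  case (step v)
  then show ?case by (metis leads_to.step)
qed (rule leads_to.here)

definition roots :: "'a set \<Rightarrow> ('a \<Rightarrow> 'a) \<Rightarrow> 'a set" where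
  "roots V p = {v \<in> V. p v = v}"

text \<open>Roots are fixed points of \<open>p\<close>; \<open>c \<noteq> v\<close> keeps a root
  from being its own child.\<close>

definition children :: "'a set \<Rightarrow> ('a \<Rightarrow> 'a) \<Rightarrow> 'a \<Rightarrow> 'a set" where
  "children V p v = {c \<in> V. p c = v \<and> c \<noteq> v}"

text \<open>The bound \<open>Suc (e v)\<close> on the children leaves a nonnegative number of
  drivers preferring \<open>v\<close>: those reaching \<open>v\<close> are the e v that leave and
  the one that parks there. Positivity at non-roots is primality, and extensionality gives each
  labelled forest one encoding.\<close>

definition excess_forest :: "'a set \<Rightarrow> ('a \<Rightarrow> 'a) \<Rightarrow> ('a \<Rightarrow> nat) \<Rightarrow> bool" where
  "excess_forest V p e \<longleftrightarrow> p \<in> V \<rightarrow>\<^sub>E V \<and> e \<in> extensional V \<and>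
     (\<forall>v\<in>V. \<exists>r. leads_to p r v \<and> p r = r) \<and> (\<forall>v\<in>V. p v \<noteq> v \<longrightarrow> 1 \<le> e v) \<and>
     (\<forall>v\<in>V. sum e (children V p v) \<le> Suc (e v))"

text \<open>Roots also get positive excess, because they become children when a new root is
  added.\<close>

definition forests :: "'a set \<Rightarrow> nat \<Rightarrow> (('a \<Rightarrow> 'a) \<times> ('a \<Rightarrow> nat)) set" where
  "forests V m = {(p, e). excess_forest V p e \<and> (\<forall>v\<in>V. 1 \<le> e v) \<and> sum e (roots V p) = m}"

definition trees :: "'a set \<Rightarrow> nat \<Rightarrow> (('a \<Rightarrow> 'a) \<times> ('a \<Rightarrow> nat)) set" where
  "trees V k = {(p, e). excess_forest V p e \<and> (\<exists>r. roots V p = {r} \<and> e r = k)}"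

section \<open>Removing and adding a root\<close>

definition prune :: "'a set \<Rightarrow> 'a \<Rightarrow> ('a \<Rightarrow> 'a) \<times> ('a \<Rightarrow> nat) \<Rightarrow> ('a \<Rightarrow> 'a) \<times> ('a \<Rightarrow> nat)" where
  "prune V r = (\<lambda>(p, e). (\<lambda>v\<in>V - {r}. if p v = r then v else p v, restrict e (V - {r})))"

definition graft :: "'a set \<Rightarrow> 'a \<Rightarrow> nat \<Rightarrow> ('a \<Rightarrow> 'a) \<times> ('a \<Rightarrow> nat) \<Rightarrow> ('a \<Rightarrow> 'a) \<times> ('a \<Rightarrow> nat)" where
  "graft V r k = (\<lambda>(p, e). (\<lambda>v\<in>V. if v = r \<or> p v = v then r else p v, e(r := k)))"

text \<open>The children of \<open>r\<close> become the roots, so the excess bound at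
  \<open>r\<close> turns into the bound on the total root excess.\<close>

lemma prune_in_forests:
  assumes t: "(p, e) \<in> trees V k" and r: "r \<in> V" "p r = r"
  shows "\<exists>i\<le>Suc k. prune V r (p, e) \<in> forests (V - {r}) i" "graft V r k (prune V r (p, e)) = (p, e)"
proof -
  define p' where "p' = (\<lambda>v\<in>V - {r}. if p v = r then v else p v)"
  define e' where "e' = restrict e (V - {r})"
  have prune: "prune V r (p, e) = (p', e')" by (simp add: prune_def p'_def e'_def)
  from t obtain r' where F: "excess_forest V p e" and "roots V p = {r'}" "e r' = k"
    by (auto simp: trees_def)
  with r have root: "roots V p = {r}" and er: "e r = k" by (auto simp: roots_def)
  have root_eq: "v = r" if "v \<in> V" "p v = v" for v using that root by (auto simp: roots_def)
  from F have p: "p \<in> V \<rightarrow>\<^sub>E V" and e: "e \<in> extensional V"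
    and lead: "\<And>v. v \<in> V \<Longrightarrow> \<exists>r. leads_to p r v \<and> p r = r"
    and pos: "\<And>v. v \<in> V \<Longrightarrow> p v \<noteq> v \<Longrightarrow> 1 \<le> e v"
    and ch: "\<And>v. v \<in> V \<Longrightarrow> sum e (children V p v) \<le> Suc (e v)"
    by (auto simp: excess_forest_def)
  have lead_r: "leads_to p r v" if "v \<in> V" for v
    using lead[OF that] p that leads_to_in[of p _ v V] root_eq by blast
  have p': "p' \<in> (V - {r}) \<rightarrow>\<^sub>E (V - {r})" using p by (auto simp: p'_def PiE_iff)
  have lead': "\<exists>r'. leads_to p' r' v \<and> p' r' = r'" if "v \<in> V - {r}" for v
  proof -
    \<comment> \<open>The old path to \<open>r\<close> is followed up to the child of
      \<open>r\<close> on it, which is a fixed point of \<open>p'\<close>.\<close>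
    have "leads_to p r v" using lead_r that by blast
    then show ?thesis using that
    proof (induction rule: leads_to.induct)
      case (step v)
      show ?case
      proof (cases "p v = r")
        case True
        then have "p' v = v" using step.prems by (simp add: p'_def)
        then show ?thesis by (blast intro: leads_to.here)
      next
        case False
        then have "p' v = p v" "p v \<in> V - {r}" using step.prems p by (auto simp: p'_def)
        then show ?thesis using step.IH by (metis leads_to.step)
      qed
    qed simp
  qed
  have ch': "children (V - {r}) p' v = children V p v" if "v \<in> V - {r}" for v
    using that r by (auto simp: children_def p'_def)
  have roots': "roots (V - {r}) p' = children V p r"
    using root_eq by (auto simp: children_def p'_def roots_def)
  have sum': "sum e' A = sum e A" if "A \<subseteq> V - {r}" for A
    using that by (intro sum.cong) (auto simp: e'_def)
  have chsub: "children V p v \<subseteq> V - {r}" for v using r by (auto simp: children_def)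
  have ext': "e' \<in> extensional (V - {r})" by (simp add: e'_def)
  have pos': "1 \<le> e' v" if "v \<in> V - {r}" for v
    using that pos[of v] root_eq[of v] by (auto simp: e'_def)
  have sums': "sum e' (children (V - {r}) p' v) \<le> Suc (e' v)" if "v \<in> V - {r}" for v
    unfolding ch'[OF that] sum'[OF chsub] using ch[of v] that by (simp add: e'_def)
  have "excess_forest (V - {r}) p' e'"
    unfolding excess_forest_def by (intro conjI ballI impI p' ext' lead' pos' sums')
  then have "(p', e') \<in> forests (V - {r}) (sum e (children V p r))"
    using pos' by (auto simp: forests_def roots' sum'[OF chsub])
  moreover have "sum e (children V p r) \<le> Suc k" using ch[OF r(1)] er by simp
  ultimately show "\<exists>i\<le>Suc k. prune V r (p, e) \<in> forests (V - {r}) i" using prune by auto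
  have "(\<lambda>v\<in>V. if v = r \<or> p' v = v then r else p' v) = p"
  proof
    fix v
    show "(\<lambda>v\<in>V. if v = r \<or> p' v = v then r else p' v) v = p v"
    proof (cases "v \<in> V")
      case True
      consider "v = r" | "v \<noteq> r" "p v = r" | "v \<noteq> r" "p v \<noteq> r" "p v \<noteq> v"
        using root_eq[OF True] by argo
      then show ?thesis
      proof cases
        case 1
        then show ?thesis using r by simp
      next
        case 2
        then have "p' v = v" using True by (simp add: p'_def)
        then show ?thesis using 2 True by simp
      next
        case 3
        then have "p' v = p v" using True by (simp add: p'_def)
        then show ?thesis using 3 True by simp
      qed
    next
      case False
      then show ?thesis using PiE_arb[OF p False] by (simp only: restrict_def if_False)
    qed
  qed
  moreover have "e'(r := k) = e"
    using e er r by (simp add: fun_eq_iff e'_def extensional_def)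
  ultimately show "graft V r k (prune V r (p, e)) = (p, e)"
    unfolding prune by (simp add: graft_def)
qed

text \<open>The hypothesis \<open>i \<le> Suc k\<close> is the excess bound at the new root; the
  bounds at all other vertices are inherited.\<close>

lemma graft_in_trees:
  assumes f: "(p, e) \<in> forests (V - {r}) i" and r: "r \<in> V" and i: "i \<le> Suc k"
  shows "graft V r k (p, e) \<in> trees V k" "roots V (fst (graft V r k (p, e))) = {r}"
    "prune V r (graft V r k (p, e)) = (p, e)"
proof -
  define p' where "p' = (\<lambda>v\<in>V. if v = r \<or> p v = v then r else p v)"
  define e' where "e' = e(r := k)"
  have graft: "graft V r k (p, e) = (p', e')" by (simp add: graft_def p'_def e'_def)
  from f have p: "p \<in> (V - {r}) \<rightarrow>\<^sub>E (V - {r})" and e: "e \<in> extensional (V - {r})"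
    and lead: "\<And>v. v \<in> V - {r} \<Longrightarrow> \<exists>r. leads_to p r v \<and> p r = r"
    and pos: "\<And>v. v \<in> V - {r} \<Longrightarrow> 1 \<le> e v"
    and ch: "\<And>v. v \<in> V - {r} \<Longrightarrow> sum e (children (V - {r}) p v) \<le> Suc (e v)"
    and rt: "sum e (roots (V - {r}) p) = i"
    by (auto simp: forests_def excess_forest_def)
  have pin: "p v \<in> V" "p v \<noteq> r" if "v \<in> V" "v \<noteq> r" for v using p that by auto
  have p': "p' \<in> V \<rightarrow>\<^sub>E V" using pin r by (auto simp: p'_def)
  have p'r: "p' r = r" using r by (simp add: p'_def)
  have lead': "leads_to p' r v" if v: "v \<in> V" for v
  proof (cases "v = r")
    case True
    then show ?thesis by (simp add: leads_to.here)
  next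
    case False
    then obtain s where "leads_to p s v" "p s = s" using lead[of v] v by blast
    moreover have "v \<in> V - {r}" using that False by simp
    ultimately show ?thesis
    proof (induction rule: leads_to.induct)
      case here
      then have "p' s = r" by (simp add: p'_def)
      then show ?case by (metis leads_to.intros)
    next
      case (step v)
      then have "leads_to p' r (p v)" using pin by auto
      moreover have "p' v = p v \<or> p' v = r" using step.prems by (auto simp: p'_def)
      ultimately show ?case by (metis leads_to.intros)
    qed
  qed
  have ch': "children V p' v = children (V - {r}) p v" if "v \<in> V - {r}" for v
    using that by (auto simp: children_def p'_def split: if_splits)
  have chr: "children V p' r = roots (V - {r}) p"
    using pin by (auto simp: children_def p'_def roots_def split: if_splits)
  have roots': "roots V p' = {r}"
    using r p'r by (auto simp: roots_def p'_def split: if_splits)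
  have sum': "sum e' A = sum e A" if "A \<subseteq> V - {r}" for A
    using that by (intro sum.cong) (auto simp: e'_def)
  have sums': "sum e' (children V p' v) \<le> Suc (e' v)" if "v \<in> V" for v
  proof (cases "v = r")
    case True
    have "sum e' (children V p' r) = i"
      using rt unfolding chr by (subst sum') (auto simp: roots_def)
    then show ?thesis using i True by (simp add: e'_def)
  next
    case False
    then have "children V p' v = children (V - {r}) p v" using ch' that by simp
    moreover have "children (V - {r}) p v \<subseteq> V - {r}" by (auto simp: children_def)
    ultimately have "sum e' (children V p' v) = sum e (children (V - {r}) p v)"
      using sum' by metis
    then show ?thesis using False that ch[of v] by (simp add: e'_def)
  qed
  have ext': "e' \<in> extensional V" using e r by (auto simp: extensional_def e'_def)
  have pos': "1 \<le> e' v" if "v \<in> V" "p' v \<noteq> v" for v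
    using that p'r pos[of v] by (auto simp: e'_def)
  have "excess_forest V p' e'"
    unfolding excess_forest_def
    by (intro conjI ballI impI p' ext' pos' sums') (use lead' p'r in blast)+
  then have "(p', e') \<in> trees V k"
    using roots' by (simp add: trees_def e'_def)
  then show "graft V r k (p, e) \<in> trees V k" by (simp add: graft)
  show "roots V (fst (graft V r k (p, e))) = {r}" by (simp add: graft roots')
  have "(\<lambda>v\<in>V - {r}. if p' v = r then v else p' v) = p"
  proof
    fix v
    show "(\<lambda>v\<in>V - {r}. if p' v = r then v else p' v) v = p v"
    proof (cases "v \<in> V - {r}")
      case True
      then show ?thesis using pin[of v] by (auto simp: p'_def)
    next
      case False
      then show ?thesis using PiE_arb[OF p False] by (simp only: restrict_def if_False)
    qed
  qed
  moreover have "restrict e' (V - {r}) = e"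
    using e by (auto simp: fun_eq_iff e'_def extensional_def)
  ultimately show "prune V r (graft V r k (p, e)) = (p, e)"
    unfolding graft by (simp add: prune_def)
qed

text \<open>A tree has one root, so it determines both the root and the pruned forest.\<close>

lemma bij_betw_graft:
  "bij_betw (\<lambda>(r, t). graft V r k t) (SIGMA r:V. \<Union>i\<le>Suc k. forests (V - {r}) i) (trees V k)"
    (is "bij_betw ?g ?A ?B")
proof -
  define R :: "('a \<Rightarrow> 'a) \<times> ('a \<Rightarrow> nat) \<Rightarrow> 'a" where "R = (\<lambda>t. the_elem (roots V (fst t)))"
  have 1: "?g a \<in> ?B \<and> (R (?g a), prune V (R (?g a)) (?g a)) = a" if "a \<in> ?A" for a
  proof -
    obtain r p e where a: "a = (r, p, e)" by (cases a)
    with that obtain i where "(p, e) \<in> forests (V - {r}) i" "r \<in> V" "i \<le> Suc k" by auto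
    from graft_in_trees[OF this] a show ?thesis by (simp add: R_def)
  qed
  have 2: "(R t, prune V (R t) t) \<in> ?A \<and> ?g (R t, prune V (R t) t) = t" if "t \<in> ?B" for t
  proof -
    obtain p e where t: "t = (p, e)" by (cases t)
    with that obtain r where r: "r \<in> V" "p r = r" "roots V p = {r}"
      by (auto simp: trees_def roots_def)
    from that t have "(p, e) \<in> trees V k" by simp
    from prune_in_forests[OF this r(1,2)] r t show ?thesis by (auto simp: R_def)
  qed
  show ?thesis
    by (rule bij_betw_byWitness[where f' = "\<lambda>t. (R t, prune V (R t) t)"])
       (use 1 2 in blast)+
qed

section \<open>Splitting off the component of a distinguished vertex\<close>

definition glue :: "'a set \<Rightarrow> ('a \<Rightarrow> 'b) \<Rightarrow> ('a \<Rightarrow> 'b) \<Rightarrow> 'a \<Rightarrow> 'b" where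
  "glue J f g = (\<lambda>v. if v \<in> J then f v else g v)"

text \<open>\<open>J\<close> is closed under parents and children, so paths and sets of children
  within \<open>J\<close> do not change.\<close>

lemma excess_forest_restrict:
  assumes F: "excess_forest V p e" and J: "J \<subseteq> V" "\<And>v. v \<in> V \<Longrightarrow> p v \<in> J \<longleftrightarrow> v \<in> J"
  shows "excess_forest J (restrict p J) (restrict e J)"
proof -
  have ch: "children J (restrict p J) v = children V p v" if "v \<in> J" for v
    using J that by (auto simp: children_def)
  have s: "sum (restrict e J) (children V p v) = sum e (children V p v)" if "v \<in> J" for v
    using J that by (intro sum.cong) (auto simp: children_def)
  have "\<exists>r. leads_to (restrict p J) r v \<and> restrict p J r = r" if v: "v \<in> J" for v
  proof -
    obtain r where r: "leads_to p r v" "p r = r"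
      using F J(1) v unfolding excess_forest_def by blast
    have pJ: "\<And>u. u \<in> J \<Longrightarrow> p u \<in> J" using J by blast
    then have "r \<in> J" using leads_to_in[OF r(1) that] by auto
    moreover have "leads_to (restrict p J) r v"
      using leads_to_cong[OF r(1) that pJ] by simp
    ultimately show ?thesis using r by auto
  qed
  moreover have "sum (restrict e J) (children J (restrict p J) v) \<le> Suc (restrict e J v)"
    if "v \<in> J" for v
    unfolding ch[OF that] s[OF that] using F J(1) that by (auto simp: excess_forest_def)
  moreover have "1 \<le> restrict e J v" if "v \<in> J" "restrict p J v \<noteq> v" for v
    using F J(1) that by (auto simp: excess_forest_def)
  moreover have "restrict p J \<in> J \<rightarrow>\<^sub>E J" using J by auto
  ultimately show ?thesis
    unfolding excess_forest_def by simp
qed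

lemma excess_forest_glue:
  assumes 1: "excess_forest J p e" and 2: "excess_forest K q f" and disj: "J \<inter> K = {}"
  shows "excess_forest (J \<union> K) (glue J p q) (glue J e f)"
proof -
  let ?p = "glue J p q" and ?e = "glue J e f"
  have p: "p v \<in> J" if "v \<in> J" for v using 1 that by (auto simp: excess_forest_def)
  have q: "q v \<in> K" if "v \<in> K" for v using 2 that by (auto simp: excess_forest_def)
  have KJ: "v \<notin> J" if "v \<in> K" for v using disj that by auto
  have JK: "v \<notin> K" if "v \<in> J" for v using disj that by auto
  have ch1: "children (J \<union> K) ?p v = children J p v" if "v \<in> J" for v
    using that by (auto simp: children_def glue_def dest: KJ q[THEN KJ])
  have ch2: "children (J \<union> K) ?p v = children K q v" if "v \<in> K" for v
    using that by (auto simp: children_def glue_def dest: KJ p[THEN JK])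
  have s1: "sum ?e (children J p v) = sum e (children J p v)" for v
    by (intro sum.cong) (auto simp: children_def glue_def)
  have s2: "sum ?e (children K q v) = sum f (children K q v)" for v
    using KJ by (intro sum.cong) (auto simp: children_def glue_def)
  have l1: "\<exists>r. leads_to ?p r v \<and> ?p r = r" if v: "v \<in> J" for v
  proof -
    obtain r where r: "leads_to p r v" "p r = r" using 1 v unfolding excess_forest_def by blast
    have "r \<in> J" using leads_to_in[OF r(1) v] p by auto
    moreover have "leads_to ?p r v" using leads_to_cong[OF r(1) v p] by (simp add: glue_def)
    ultimately show ?thesis using r by (auto simp: glue_def)
  qed
  have l2: "\<exists>r. leads_to ?p r v \<and> ?p r = r" if v: "v \<in> K" for v
  proof -
    obtain r where r: "leads_to q r v" "q r = r" using 2 v unfolding excess_forest_def by blast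
    have "r \<in> K" using leads_to_in[OF r(1) v] q by auto
    moreover have "leads_to ?p r v" using leads_to_cong[OF r(1) v q] KJ by (simp add: glue_def)
    ultimately show ?thesis using r KJ by (auto simp: glue_def)
  qed
  have "q \<in> K \<rightarrow>\<^sub>E K" "f \<in> extensional K" "e \<in> extensional J"
    using 1 2 by (simp_all add: excess_forest_def)
  then have "?p v = undefined" "?e v = undefined" if "v \<notin> J \<union> K" for v
    using that PiE_arb[of q K "\<lambda>_. K" v] extensional_arb[of f K v] by (simp_all add: glue_def)
  moreover have "?p v \<in> J \<union> K" if "v \<in> J \<union> K" for v
    using p[of v] q[of v] that by (cases "v \<in> J") (simp_all add: glue_def)
  ultimately have "?p \<in> J \<union> K \<rightarrow>\<^sub>E J \<union> K" "?e \<in> extensional (J \<union> K)"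
    by (blast intro: PiE_I, simp add: extensional_def)
  moreover have "1 \<le> ?e v" if "v \<in> J \<union> K" "?p v \<noteq> v" for v
  proof (cases "v \<in> J")
    case True
    then show ?thesis using 1 that by (simp add: excess_forest_def glue_def)
  next
    case False
    then show ?thesis using 2 that by (simp add: excess_forest_def glue_def)
  qed
  moreover have "sum ?e (children (J \<union> K) ?p v) \<le> Suc (?e v)" if "v \<in> J \<union> K" for v
  proof (cases "v \<in> J")
    case True
    then show ?thesis using 1 unfolding ch1[OF True] s1 by (simp add: excess_forest_def glue_def)
  next
    case False
    with that have "v \<in> K" by simp
    then show ?thesis using 2 False unfolding ch2[OF \<open>v \<in> K\<close>] s2
      by (simp add: excess_forest_def glue_def)
  qed
  ultimately show ?thesis
    using l1 l2 unfolding excess_forest_def by blast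
qed

definition component :: "'a set \<Rightarrow> ('a \<Rightarrow> 'a) \<Rightarrow> 'a \<Rightarrow> 'a set" where
  "component V p w = {v \<in> V. \<exists>r. leads_to p r v \<and> leads_to p r w \<and> p r = r}"

lemma component_closed:
  assumes "excess_forest V p e" "v \<in> V"
  shows "p v \<in> component V p w \<longleftrightarrow> v \<in> component V p w"
  using assms by (auto simp: component_def excess_forest_def intro: leads_to.step leads_to_parent)

lemma excess_forest_root:
  assumes "excess_forest V p e" "v \<in> V"
  obtains r where "r \<in> roots V p" "leads_to p r v"
proof -
  obtain r where r: "leads_to p r v" "p r = r" using assms by (auto simp: excess_forest_def)
  moreover have "p \<in> V \<rightarrow> V" using assms by (auto simp: excess_forest_def)
  then have "r \<in> V" using leads_to_in[OF r(1) assms(2)] by blast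
  ultimately show ?thesis using that by (auto simp: roots_def)
qed

lemma roots_component:
  assumes "excess_forest V p e" "r \<in> roots V p" "leads_to p r w" "w \<in> V"
  shows "roots V p \<inter> component V p w = {r}"
  using assms by (auto simp: roots_def component_def dest: leads_to_root_unique intro: leads_to.here)

text \<open>\<open>J\<close> meets the roots in one vertex, so the sum is the excess of that root,
  obtained without choosing it.\<close>

definition split_forest where
  "split_forest V w = (\<lambda>(p, e). let J = component V p w in
     ((J, sum e (roots V p \<inter> J)), (restrict p J, restrict e J), restrict p (V - J), restrict e (V - J)))"

definition join_forest :: "('a set \<times> nat) \<times> (('a \<Rightarrow> 'a) \<times> ('a \<Rightarrow> nat)) \<times> ('a \<Rightarrow> 'a) \<times> ('a \<Rightarrow> nat)
    \<Rightarrow> ('a \<Rightarrow> 'a) \<times> ('a \<Rightarrow> nat)" where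
  "join_forest = (\<lambda>((J, k), (p, e), q, f). (glue J p q, glue J e f))"

text \<open>Keeping \<open>J\<close> and \<open>k\<close> in the tuple makes this a dependent sum
  over products, whose cardinality is the sum in \<open>forest_count_Suc\<close>.\<close>

definition split_forests where
  "split_forests V w m = (SIGMA (J, k):{J. J \<subseteq> V \<and> w \<in> J} \<times> {1..m}. trees J k \<times> forests (V - J) (m - k))"

lemma restrict_roots:
  "J \<subseteq> V \<Longrightarrow> roots J (restrict p J) = roots V p \<inter> J"
  by (auto simp: roots_def)

lemma split_forest_in:
  assumes V: "finite V" and w: "w \<in> V" and pe: "(p, e) \<in> forests V m"
  shows "split_forest V w (p, e) \<in> split_forests V w m" "join_forest (split_forest V w (p, e)) = (p, e)"
proof -
  define J where "J = component V p w"
  from pe have F: "excess_forest V p e" and pos: "\<And>v. v \<in> V \<Longrightarrow> 1 \<le> e v"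
    and m: "sum e (roots V p) = m" by (auto simp: forests_def)
  obtain r where r: "r \<in> roots V p" "leads_to p r w" using excess_forest_root[OF F w] .
  have rJ: "roots V p \<inter> J = {r}" unfolding J_def using roots_component[OF F r w] .
  have J: "J \<subseteq> V" "w \<in> J" using r w by (auto simp: J_def component_def roots_def)
  have cl: "p v \<in> J \<longleftrightarrow> v \<in> J" if "v \<in> V" for v
    using component_closed[OF F that] by (simp add: J_def)
  have F1: "excess_forest J (restrict p J) (restrict e J)"
    using excess_forest_restrict[OF F J(1) cl] by simp
  have pV: "p v \<in> V" if "v \<in> V" for v using F that by (auto simp: excess_forest_def)
  have F2: "excess_forest (V - J) (restrict p (V - J)) (restrict e (V - J))"
    using excess_forest_restrict[OF F, of "V - J"] cl pV by auto
  have "sum e (roots V p) = sum e (roots V p \<inter> J) + sum e (roots V p \<inter> (V - J))"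
    using V by (subst sum.union_disjoint[symmetric])
      (auto simp: roots_def intro!: arg_cong[of _ _ "sum e"])
  then have msum: "m = e r + sum e (roots V p \<inter> (V - J))" using m rJ by simp
  have "e r \<ge> 1" using pos r by (auto simp: roots_def)
  moreover have "(restrict p J, restrict e J) \<in> trees J (e r)"
    using F1 rJ J(1) by (auto simp: trees_def restrict_roots)
  moreover have "sum (restrict e (V - J)) (roots V p \<inter> (V - J)) = m - e r"
    using msum by simp
  then have "(restrict p (V - J), restrict e (V - J)) \<in> forests (V - J) (m - e r)"
    using F2 pos restrict_roots[of "V - J" V p] by (simp add: forests_def)
  ultimately show "split_forest V w (p, e) \<in> split_forests V w m"
    using J msum by (simp add: split_forest_def split_forests_def rJ flip: J_def)
  \<comment> \<open>Outside \<open>V\<close> both the original and the glued maps are undefined, so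
    gluing restores them everywhere.\<close>
  have "p \<in> extensional V" "e \<in> extensional V" using F by (auto simp: excess_forest_def PiE_def)
  then show "join_forest (split_forest V w (p, e)) = (p, e)"
    using J by (auto simp: split_forest_def join_forest_def glue_def fun_eq_iff extensional_def
        simp flip: J_def)
qed

lemma join_forest_in:
  assumes V: "finite V" and J: "J \<subseteq> V" "w \<in> J" and k: "1 \<le> k" "k \<le> m"
    and t: "(p, e) \<in> trees J k" and f: "(q, f) \<in> forests (V - J) (m - k)"
  shows "join_forest ((J, k), (p, e), q, f) \<in> forests V m"
    "split_forest V w (join_forest ((J, k), (p, e), q, f)) = ((J, k), (p, e), q, f)"
proof -
  let ?p = "glue J p q" and ?e = "glue J e f"
  obtain r where F1: "excess_forest J p e" and r: "roots J p = {r}" "e r = k"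
    using t by (auto simp: trees_def)
  from f have F2: "excess_forest (V - J) q f" and pos: "\<And>v. v \<in> V - J \<Longrightarrow> 1 \<le> f v"
    and fm: "sum f (roots (V - J) q) = m - k" by (auto simp: forests_def)
  have F: "excess_forest V ?p ?e"
    using excess_forest_glue[OF F1 F2] J by (simp add: Un_absorb1)
  have roots: "roots V ?p = insert r (roots (V - J) q)"
    using r J by (auto simp: roots_def glue_def)
  have rJ: "r \<in> J" "p r = r" using r by (auto simp: roots_def)
  have "sum ?e (roots V ?p) = k + sum ?e (roots (V - J) q)"
    unfolding roots using V rJ r by (subst sum.insert) (auto simp: roots_def glue_def)
  also have "sum ?e (roots (V - J) q) = m - k"
    unfolding fm[symmetric] by (intro sum.cong) (auto simp: roots_def glue_def)
  finally have "sum ?e (roots V ?p) = m" using k by simp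
  moreover have "1 \<le> ?e v" if "v \<in> V" for v
  proof (cases "v \<in> J")
    case True
    \<comment> \<open>A tree guarantees positive excess only at non-roots; at its root this is
      \<open>1 \<le> k\<close>.\<close>
    then have "p v \<noteq> v \<or> v = r" using r by (auto simp: roots_def)
    then show ?thesis using F1 True r k by (auto simp: glue_def excess_forest_def)
  qed (use that pos in \<open>auto simp: glue_def\<close>)
  ultimately show "join_forest ((J, k), (p, e), q, f) \<in> forests V m"
    using F by (auto simp: forests_def join_forest_def)
  have pJ: "p v \<in> J" if "v \<in> J" for v using F1 that by (auto simp: excess_forest_def)
  have qK: "q v \<in> V - J" if "v \<in> V - J" for v using F2 that by (auto simp: excess_forest_def)
  have leads: "leads_to ?p r v" if "v \<in> J" for v
  proof -
    have "leads_to p r v" using excess_forest_root[OF F1 that] r by auto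
    from leads_to_cong[OF this that pJ] show ?thesis by (simp add: glue_def)
  qed
  \<comment> \<open>Both \<open>J\<close> and \<open>V - J\<close> are closed under the glued map,
    so a vertex sharing its root with \<open>w\<close> lies in \<open>J\<close>.\<close>
  have "component V ?p w = J"
  proof (intro equalityI subsetI)
    fix v assume "v \<in> J"
    then show "v \<in> component V ?p w"
      using leads[of v] leads[of w] J rJ by (auto simp: component_def glue_def)
  next
    fix v assume "v \<in> component V ?p w"
    then obtain s where s: "v \<in> V" "leads_to ?p s v" "leads_to ?p s w" "?p s = s"
      by (auto simp: component_def)
    have "s \<in> J" using leads_to_in[OF s(3), of J] J pJ by (auto simp: glue_def)
    moreover have "s \<in> V - J" if "v \<notin> J"
      using leads_to_in[OF s(2), of "V - J"] s(1) that qK by (auto simp: glue_def)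
    ultimately show "v \<in> J" by blast
  qed
  moreover have "roots V ?p \<inter> J = {r}" using roots rJ by (auto simp: roots_def)
  moreover have "restrict ?p J = p" "restrict ?e J = e" "restrict ?p (V - J) = q"
    "restrict ?e (V - J) = f"
    using F1 F2 by (auto simp: excess_forest_def PiE_def extensional_def glue_def fun_eq_iff)
  ultimately show "split_forest V w (join_forest ((J, k), (p, e), q, f)) = ((J, k), (p, e), q, f)"
    using r rJ by (simp add: split_forest_def join_forest_def glue_def)
qed

text \<open>The combinatorial form of E_x = F_x E: marking \<open>w\<close> singles out one
  component, so no set partitions are needed.\<close>

lemma bij_betw_join_forest:
  assumes "finite V" "w \<in> V"
  shows "bij_betw join_forest (split_forests V w m) (forests V m)"
proof -
  have 1: "join_forest a \<in> forests V m \<and> split_forest V w (join_forest a) = a"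
    if "a \<in> split_forests V w m" for a
  proof -
    obtain J k p e q f where a: "a = ((J, k), (p, e), q, f)" by (cases a) auto
    with that have "J \<subseteq> V" "w \<in> J" "1 \<le> k" "k \<le> m" "(p, e) \<in> trees J k"
      "(q, f) \<in> forests (V - J) (m - k)" by (auto simp: split_forests_def)
    from join_forest_in[OF assms(1) this] show ?thesis by (simp add: a)
  qed
  have 2: "split_forest V w t \<in> split_forests V w m \<and> join_forest (split_forest V w t) = t"
    if "t \<in> forests V m" for t
    using split_forest_in[OF assms, of "fst t" "snd t" m] that by simp
  show ?thesis
    by (rule bij_betw_byWitness[where f' = "split_forest V w"]) (use 1 2 in blast)+
qed

section \<open>Cardinalities of the sets of trees and forests\<close>

text \<open>Assuming the forest counts only for sets with one vertex removed makes this usable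
  inside the induction on forests.\<close>

lemma trees_finite_card:
  assumes V: "finite V"
    and fin: "\<And>r i. r \<in> V \<Longrightarrow> finite (forests (V - {r}) i)"
    and card: "\<And>r i. r \<in> V \<Longrightarrow> card (forests (V - {r}) i) = forest_count (card V - 1) i"
  shows "finite (trees V k) \<and> card (trees V k) = tree_count (card V) k"
proof
  let ?S = "SIGMA r:V. \<Union>i\<le>Suc k. forests (V - {r}) i"
  have "finite ?S" using V fin by auto
  then show "finite (trees V k)" using bij_betw_finite[OF bij_betw_graft] by blast
  have "card (trees V k) = card ?S" using bij_betw_same_card[OF bij_betw_graft] by metis
  also have "\<dots> = (\<Sum>r\<in>V. card (\<Union>i\<le>Suc k. forests (V - {r}) i))"
    using V fin by (intro card_SigmaI) auto
  also have "\<dots> = (\<Sum>r\<in>V. \<Sum>i\<le>Suc k. forest_count (card V - 1) i)"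
  proof (rule sum.cong[OF refl])
    fix r assume r: "r \<in> V"
    \<comment> \<open>The union is disjoint, as \<open>i\<close> is the total root excess of the
      forest.\<close>
    have "card (\<Union>i\<le>Suc k. forests (V - {r}) i) = (\<Sum>i\<le>Suc k. card (forests (V - {r}) i))"
      using fin[OF r] by (intro card_UN_disjoint) (auto simp: forests_def)
    then show "card (\<Union>i\<le>Suc k. forests (V - {r}) i) = (\<Sum>i\<le>Suc k. forest_count (card V - 1) i)"
      using card[OF r] by simp
  qed
  finally show "card (trees V k) = tree_count (card V) k" by (simp add: tree_count_def)
qed

lemma sum_Pow_card:
  fixes h :: "nat \<Rightarrow> nat"
  assumes "finite A"
  shows "(\<Sum>B\<in>Pow A. h (card B)) = (\<Sum>j\<le>card A. (card A choose j) * h j)"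
proof -
  have "(\<Sum>B\<in>Pow A. h (card B)) = (\<Sum>j\<le>card A. \<Sum>B\<in>{B \<in> Pow A. card B = j}. h (card B))"
    using assms by (intro sum.group[symmetric]) (auto intro: card_mono)
  also have "\<dots> = (\<Sum>j\<le>card A. (card A choose j) * h j)"
    using n_subsets[OF assms] by (intro sum.cong) (auto simp: Pow_def)
  finally show ?thesis .
qed

text \<open>Strong induction on the size: a tree on \<open>J\<close> reduces to forests on
  \<open>J - {r}\<close>, smaller even for J = V, and the remaining forest misses \<open>w\<close>.
  Finiteness is carried along for the cardinalities of unions and sums.\<close>

lemma forests_finite_card:
  assumes "finite V"
  shows "finite (forests V m) \<and> card (forests V m) = forest_count (card V) m"
  using assms
proof (induction "card V" arbitrary: V m rule: less_induct)
  case less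
  show ?case
  proof (cases "V = {}")
    case True
    have "forests V m = (if m = 0 then {(\<lambda>_. undefined, \<lambda>_. undefined)} else {})"
      using True by (auto simp: forests_def excess_forest_def roots_def)
    then show ?thesis using True by simp
  next
    case False
    then obtain w where w: "w \<in> V" by auto
    define A where "A = V - {w}"
    have A: "finite A" "w \<notin> A" "V = insert w A" using w less.prems by (auto simp: A_def)
    define n where "n = card A"
    have cV: "card V = Suc n" using A by (simp add: n_def)
    have trees: "finite (trees J k) \<and> card (trees J k) = tree_count (card J) k"
      if "J \<subseteq> V" for J :: "'a set" and k
    proof (rule trees_finite_card)
      show fJ: "finite J" using that less.prems finite_subset by blast
      fix r :: 'a and i assume r: "r \<in> J"
      have "card (J - {r}) < card V"
        using r that less.prems by (intro psubset_card_mono) auto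
      with less.hyps[of "J - {r}" i] fJ r
      show "finite (forests (J - {r}) i)" "card (forests (J - {r}) i) = forest_count (card J - 1) i"
        by auto
    qed
    have forests: "finite (forests (V - J) i) \<and> card (forests (V - J) i) = forest_count (card V - card J) i"
      if "J \<subseteq> V" "w \<in> J" for J :: "'a set" and i
    proof -
      have "card (V - J) < card V" using that less.prems w by (intro psubset_card_mono) auto
      moreover have "card (V - J) = card V - card J"
        using that less.prems by (meson card_Diff_subset finite_subset)
      ultimately show ?thesis using less.hyps[of "V - J" i] less.prems by auto
    qed
    let ?I = "{J. J \<subseteq> V \<and> w \<in> J}"
    have finI: "finite ?I" using less.prems by auto
    have bij: "bij_betw join_forest (split_forests V w m) (forests V m)"
      using bij_betw_join_forest less.prems w .
    have fin: "finite (split_forests V w m)"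
      unfolding split_forests_def using finI trees forests by (intro finite_SigmaI) auto
    then have "finite (forests V m)" using bij_betw_finite[OF bij] by blast
    have "card (forests V m) = card (split_forests V w m)"
      using bij_betw_same_card[OF bij] by simp
    also have "\<dots> = (\<Sum>(J, k)\<in>?I \<times> {1..m}. card (trees J k) * card (forests (V - J) (m - k)))"
      unfolding split_forests_def using finI trees forests
      by (subst card_SigmaI) (auto simp: card_cartesian_product intro!: sum.cong)
    also have "\<dots> = (\<Sum>J\<in>?I. \<Sum>k=1..m. tree_count (card J) k * forest_count (card V - card J) (m - k))"
      unfolding sum.cartesian_product[symmetric]
      using trees forests by (intro sum.cong refl) auto
    \<comment> \<open>The component of \<open>w\<close> is \<open>insert w B\<close> for an
      arbitrary subset \<open>B\<close> of the other vertices.\<close>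
    also have "\<dots> = (\<Sum>B\<in>Pow A. \<Sum>k=1..m. tree_count (Suc (card B)) k * forest_count (n - card B) (m - k))"
    proof (rule sum.reindex_bij_witness[where i = "insert w" and j = "\<lambda>J. J - {w}"])
      fix J assume "J \<in> ?I"
      moreover from this have "finite J" using less.prems finite_subset by blast
      ultimately have "card J = Suc (card (J - {w}))" using card_Suc_Diff1[of J w] by auto
      then show "(\<Sum>k=1..m. tree_count (Suc (card (J - {w}))) k * forest_count (n - card (J - {w})) (m - k))
        = (\<Sum>k=1..m. tree_count (card J) k * forest_count (card V - card J) (m - k))"
        by (simp add: cV)
    qed (use A in auto)
    also have "\<dots> = forest_count (card V) m"
      using sum_Pow_card[OF A(1), of "\<lambda>j. \<Sum>k=1..m. tree_count (Suc j) k * forest_count (n - j) (m - k)"]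
      by (simp add: cV forest_count_Suc n_def)
    finally show ?thesis using \<open>finite (forests V m)\<close> by simp
  qed
qed

lemma card_trees:
  assumes "finite V"
  shows "card (trees V k) = tree_count (card V) k"
  using trees_finite_card[of V k] forests_finite_card[of "V - {_}"] assms by simp

section \<open>Subtrees\<close>

lemma leads_to_iff_funpow: "leads_to p r v \<longleftrightarrow> (\<exists>k. (p ^^ k) v = r)"
proof
  show "leads_to p r v \<Longrightarrow> \<exists>k. (p ^^ k) v = r"
  proof (induction rule: leads_to.induct)
    case here
    show ?case by (rule exI[of _ 0]) simp
  next
    case (step v)
    then obtain k where "(p ^^ k) (p v) = r" by blast
    then have "(p ^^ Suc k) v = r" by (simp add: funpow_swap1)
    then show ?case by blast
  qed
  have "leads_to p ((p ^^ k) v) v" for k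
  proof (induction k arbitrary: v)
    case (Suc k)
    show ?case unfolding funpow_Suc_right comp_apply by (rule leads_to.step[OF Suc.IH])
  qed (simp add: leads_to.here)
  then show "\<exists>k. (p ^^ k) v = r \<Longrightarrow> leads_to p r v" by blast
qed

lemma leads_to_trans:
  assumes "leads_to p b u" "leads_to p a b"
  shows "leads_to p a u"
  using assms by (induction rule: leads_to.induct) (simp_all add: leads_to.step)

lemma leads_to_parent_self: "leads_to p (p v) v"
  by (rule leads_to.step[OF leads_to.here])

text \<open>Both vertices lie on the single path that starts at \<open>u\<close>.\<close>

lemma leads_to_comparable:
  assumes "leads_to p a u" "leads_to p b u"
  shows "leads_to p a b \<or> leads_to p b a"
  using assms
proof (induction rule: leads_to.induct)
  case (step u)
  show ?case
  proof (cases "b = u")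
    case True
    then show ?thesis using leads_to.step[OF step.hyps] by simp
  next
    case False
    then show ?thesis using step by (metis leads_to.cases)
  qed
qed simp

lemma leads_to_fixed:
  assumes "leads_to p c r" "p r = r"
  shows "c = r"
  using assms by (induction rule: leads_to.induct) auto

text \<open>A path that reaches a fixed point cannot run through a proper cycle. In the step, a
  cycle through \<open>v\<close> also passes through \<open>p v\<close>, where the induction
  hypothesis collapses it.\<close>

lemma leads_to_antisym:
  assumes "leads_to p r v" "p r = r" "leads_to p c v" "leads_to p v c"
  shows "c = v"
  using assms
proof (induction arbitrary: c rule: leads_to.induct)
  case here
  then show ?case using leads_to_fixed by metis
next
  case (step v)
  show ?case
  proof (rule ccontr)
    assume "c \<noteq> v"
    then have c: "leads_to p c (p v)" using step.prems by (metis leads_to.cases)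
    note pv = leads_to_parent_self[of p v]
    have "leads_to p (p v) c" using leads_to_trans[OF step.prems(3) pv] .
    with c have "c = p v" using step by blast
    then have "v = p v" using step pv by metis
    with \<open>c = p v\<close> \<open>c \<noteq> v\<close> show False by simp
  qed
qed

lemma leads_to_child:
  assumes "leads_to p v u" "u \<noteq> v"
  shows "\<exists>c. leads_to p c u \<and> p c = v \<and> c \<noteq> v"
  using assms
proof (induction rule: leads_to.induct)
  case (step u)
  show ?case
  proof (cases "p u = v")
    case True
    then show ?thesis using step.prems by (blast intro: leads_to.here)
  next
    case False
    then show ?thesis using step by (blast intro: leads_to.step)
  qed
qed simp

definition below :: "'a set \<Rightarrow> ('a \<Rightarrow> 'a) \<Rightarrow> 'a \<Rightarrow> 'a set" where
  "below V p v = {u \<in> V. leads_to p v u}"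

lemma subtree_eq_below: "subtree n p v = below {1..n} p v"
  by (simp add: subtree_def below_def leads_to_iff_funpow)

locale finite_forest =
  fixes V :: "'a set" and p :: "'a \<Rightarrow> 'a"
  assumes finite_V: "finite V" and maps: "p \<in> V \<rightarrow> V"
    and rooted: "\<And>v. v \<in> V \<Longrightarrow> \<exists>r. leads_to p r v \<and> p r = r"
begin

lemma finite_below [simp]: "finite (below V p v)"
  using finite_V by (simp add: below_def)

lemma finite_children [simp]: "finite (children V p v)"
  using finite_V by (simp add: children_def)

lemma below_self: "v \<in> V \<Longrightarrow> v \<in> below V p v"
  by (simp add: below_def leads_to.here)

lemma leads_to_antisym_in: "\<lbrakk>v \<in> V; leads_to p c v; leads_to p v c\<rbrakk> \<Longrightarrow> c = v"
  using rooted leads_to_antisym by metis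

lemma below_unfold:
  assumes "v \<in> V"
  shows "below V p v = insert v (\<Union>c\<in>children V p v. below V p c)"
proof (intro equalityI subsetI)
  fix u assume u: "u \<in> below V p v"
  show "u \<in> insert v (\<Union>c\<in>children V p v. below V p c)"
  proof (cases "u = v")
    case False
    then obtain c where "leads_to p c u" "p c = v" "c \<noteq> v"
      using u leads_to_child[of p v u] by (auto simp: below_def)
    moreover have "c \<in> V" using leads_to_in[OF \<open>leads_to p c u\<close> _ maps] u by (simp add: below_def)
    ultimately show ?thesis using u by (auto simp: below_def children_def)
  qed simp
next
  fix u assume "u \<in> insert v (\<Union>c\<in>children V p v. below V p c)"
  then show "u \<in> below V p v"
    using below_self[OF assms] leads_to_trans[OF _ leads_to_parent_self[of p]]
    by (auto simp: below_def children_def)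
qed

lemma not_below_child:
  assumes "v \<in> V" "c \<in> children V p v"
  shows "v \<notin> below V p c"
proof
  assume "v \<in> below V p c"
  moreover have "leads_to p v c" using assms leads_to_parent_self[of p c] by (simp add: children_def)
  ultimately have "c = v" using leads_to_antisym_in assms by (auto simp: below_def)
  then show False using assms by (simp add: children_def)
qed

lemma below_children_disjoint:
  assumes v: "v \<in> V" and c: "c \<in> children V p v" "d \<in> children V p v" "c \<noteq> d"
  shows "below V p c \<inter> below V p d = {}"
proof -
  have *: False if "leads_to p a b" "a \<in> children V p v" "b \<in> children V p v" "a \<noteq> b" for a b
  proof -
    have "leads_to p a v" using leads_to_trans[OF that(1)] leads_to.cases[OF that(1)] that
      by (auto simp: children_def)
    then show False using not_below_child[OF v that(2)] v by (simp add: below_def)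
  qed
  show ?thesis
  proof (rule ccontr)
    assume "\<not> ?thesis"
    then obtain u where "leads_to p c u" "leads_to p d u" by (auto simp: below_def)
    then show False using leads_to_comparable * c by metis
  qed
qed

lemma sum_below:
  fixes h :: "'a \<Rightarrow> nat"
  assumes "v \<in> V"
  shows "sum h (below V p v) = h v + (\<Sum>c\<in>children V p v. sum h (below V p c))"
proof -
  have "sum h (below V p v) = h v + sum h (\<Union>c\<in>children V p v. below V p c)"
    unfolding below_unfold[OF assms] using not_below_child[OF assms] by (subst sum.insert) auto
  also have "sum h (\<Union>c\<in>children V p v. below V p c) = (\<Sum>c\<in>children V p v. sum h (below V p c))"
    using below_children_disjoint[OF assms] by (intro sum.UNION_disjoint) auto
  finally show ?thesis .
qed

lemma card_below:
  assumes "v \<in> V"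
  shows "card (below V p v) = 1 + (\<Sum>c\<in>children V p v. card (below V p c))"
  using sum_below[OF assms, of "\<lambda>_. 1"] by simp

text \<open>The recursion over children determines \<open>f\<close>, by induction on the size of the
  subtree.\<close>

lemma sum_below_unique:
  fixes f h :: "'a \<Rightarrow> nat"
  assumes rec: "\<And>v. v \<in> V \<Longrightarrow> f v = h v + sum f (children V p v)" and "v \<in> V"
  shows "f v = sum h (below V p v)"
  using assms(2)
proof (induction "card (below V p v)" arbitrary: v rule: less_induct)
  case less
  have "f c = sum h (below V p c)" if c: "c \<in> children V p v" for c
  proof (rule less.hyps)
    have "below V p c \<subset> below V p v"
      using below_unfold[OF less.prems] not_below_child[OF less.prems c] c by auto
    then show "card (below V p c) < card (below V p v)" by (intro psubset_card_mono) auto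
    show "c \<in> V" using c by (simp add: children_def)
  qed
  then show ?case using rec[OF less.prems] sum_below[OF less.prems, of h] by simp
qed

text \<open>The excess of a vertex counts the drivers that leave its subtree, so the drivers preferring
  the vertex itself are counted by a local difference.\<close>
lemma excess_recursion:
  fixes e h :: "'a \<Rightarrow> nat"
  assumes e: "\<And>v. v \<in> V \<Longrightarrow> e v + card (below V p v) = sum h (below V p v)" and v: "v \<in> V"
  shows "Suc (e v) = h v + sum e (children V p v)"
proof -
  have "(\<Sum>c\<in>children V p v. sum h (below V p c)) = (\<Sum>c\<in>children V p v. e c + card (below V p c))"
    using e by (intro sum.cong) (auto simp: children_def)
  then show ?thesis
    using sum_below[OF v, of h] card_below[OF v] e[OF v] by (simp add: sum.distrib)
qed

text \<open>Converse of \<open>excess_recursion\<close>: excess plus subtree size satisfies the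
  recursion that characterizes the sum of \<open>h\<close> over the subtree.\<close>

lemma excess_sum:
  fixes e h :: "'a \<Rightarrow> nat"
  assumes e: "\<And>v. v \<in> V \<Longrightarrow> Suc (e v) = h v + sum e (children V p v)" and v: "v \<in> V"
  shows "e v + card (below V p v) = sum h (below V p v)"
  by (rule sum_below_unique[where f = "\<lambda>v. e v + card (below V p v)", OF _ v])
     (simp add: card_below sum.distrib flip: e add_Suc)

end

section \<open>Prime parking distributions\<close>

lemma spot_None:
  assumes "spot p Occ x = None" "leads_to p v x"
  shows "v \<in> Occ"
  using assms by (auto simp: spot_def leads_to_iff_funpow split: if_splits)

lemma spot_Some:
  assumes "spot p Occ x = Some u"
  shows "u \<notin> Occ" "leads_to p u x" "\<And>v. v \<notin> Occ \<Longrightarrow> leads_to p v x \<Longrightarrow> leads_to p v u"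
proof -
  define k where "k = (LEAST k. (p ^^ k) x \<notin> Occ)"
  from assms have ex: "\<exists>k. (p ^^ k) x \<notin> Occ" and u: "u = (p ^^ k) x"
    by (auto simp: spot_def k_def split: if_splits)
  show "u \<notin> Occ" unfolding u k_def using LeastI_ex[OF ex] .
  show "leads_to p u x" unfolding leads_to_iff_funpow u by blast
  fix v assume v: "v \<notin> Occ" "leads_to p v x"
  then obtain j where j: "(p ^^ j) x = v" by (auto simp: leads_to_iff_funpow)
  then have "k \<le> j" unfolding k_def using v by (intro Least_le) simp
  then have "(p ^^ (j - k)) u = v"
    unfolding u j[symmetric] by (simp flip: funpow_add comp_apply[of "p ^^ (j - k)"])
  then show "leads_to p v u" by (auto simp: leads_to_iff_funpow)
qed

text \<open>The set of occupied vertices when the parking process carries on after a driver has left.\<close>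
fun park_all :: "(nat \<Rightarrow> nat) \<Rightarrow> nat set \<Rightarrow> nat list \<Rightarrow> nat set" where
  "park_all p Occ [] = Occ"
| "park_all p Occ (x # xs) = (case spot p Occ x of None \<Rightarrow> park_all p Occ xs
     | Some u \<Rightarrow> park_all p (insert u Occ) xs)"

lemma park_all_mono: "Occ \<subseteq> park_all p Occ xs"
proof (induction xs arbitrary: Occ)
  case (Cons x xs)
  then show ?case by (cases "spot p Occ x") (simp, metis insert_subset option.case(2) park_all.simps(2))
qed simp

lemma finite_park_all: "finite Occ \<Longrightarrow> finite (park_all p Occ xs)"
  by (induction xs arbitrary: Occ) (auto split: option.splits)

lemma card_park_all:
  assumes "finite Occ"
  shows "card (park_all p Occ xs) \<le> card Occ + length xs"
  using assms
proof (induction xs arbitrary: Occ)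
  case (Cons x xs)
  show ?case
  proof (cases "spot p Occ x")
    case None
    then show ?thesis using Cons.IH[OF Cons.prems] by simp
  next
    case (Some u)
    then show ?thesis
      using Cons.IH[of "insert u Occ"] Cons.prems spot_Some(1)[OF Some] by simp
  qed
qed simp

lemma card_park_all_None:
  assumes "finite Occ" "park p Occ xs = None"
  shows "card (park_all p Occ xs) < card Occ + length xs"
  using assms
proof (induction xs arbitrary: Occ)
  case (Cons x xs)
  show ?case
  proof (cases "spot p Occ x")
    case None
    then show ?thesis using card_park_all[OF Cons.prems(1), of p xs] by simp
  next
    case (Some u)
    then show ?thesis
      using Cons.IH[of "insert u Occ"] Cons.prems spot_Some(1)[OF Some] by simp
  qed
qed simp

text \<open>While \<open>v\<close> is empty nobody drives past it. So a driver parks in the subtree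
  of \<open>v\<close> exactly when preferring a vertex there.\<close>

lemma park_all_below:
  assumes "p \<in> V \<rightarrow> V" "set xs \<subseteq> V" "finite Occ" "v \<notin> park_all p Occ xs"
  shows "length (filter (\<lambda>x. x \<in> below V p v) xs) + card (Occ \<inter> below V p v)
       = card (park_all p Occ xs \<inter> below V p v)"
  using assms
proof (induction xs arbitrary: Occ)
  case (Cons x xs)
  have x: "x \<in> V" using Cons.prems by simp
  show ?case
  proof (cases "spot p Occ x")
    case None
    then have "v \<notin> Occ" using Cons.prems(4) park_all_mono[of Occ p xs] by auto
    then have "x \<notin> below V p v" using spot_None[OF None] by (auto simp: below_def)
    then show ?thesis using Cons None by simp
  next
    case (Some u)
    note u = spot_Some[OF Some]
    have "v \<notin> insert u Occ"
      using Cons.prems(4) Some park_all_mono[of "insert u Occ" p xs] by auto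
    then have "x \<in> below V p v \<longleftrightarrow> u \<in> below V p v"
      using u x leads_to_in[OF u(2) x Cons.prems(1)] leads_to_trans[OF u(2)] by (auto simp: below_def)
    then show ?thesis
      using Cons.IH[of "insert u Occ"] Cons.prems Some u(1)
      by (simp add: Int_insert_left split: if_splits)
  qed
qed simp

lemma length_filter_mem_eq_sum:
  assumes "finite X"
  shows "length (filter (\<lambda>x. x \<in> X) s) = sum (count_list s) X"
proof (induction s)
  case (Cons x s)
  have "sum (count_list (x # s)) X = (\<Sum>v\<in>X. (if v = x then 1 else 0) + count_list s v)"
    by (intro sum.cong) auto
  then show ?case using Cons assms by (simp add: sum.distrib)
qed simp

text \<open>If a driver left, some \<open>v\<close> would stay empty. All drivers preferring the
  subtree of \<open>v\<close> would then park in it without using \<open>v\<close>, but there are at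
  least as many of them as vertices in it.\<close>

lemma park_succeeds:
  assumes F: "finite_forest {1..n} p" and s: "length s = n" "set s \<subseteq> {1..n}"
    and le: "\<And>v. v \<in> {1..n} \<Longrightarrow> card (below {1..n} p v) \<le> sum (count_list s) (below {1..n} p v)"
  shows "park p {} s \<noteq> None"
proof
  interpret finite_forest "{1..n}" p by (rule F)
  assume "park p {} s = None"
  then have "card (park_all p {} s) < n" using card_park_all_None[of "{}" p s] s by simp
  then have "\<not> {1..n} \<subseteq> park_all p {} s"
    using card_mono[of "park_all p {} s" "{1..n}"] finite_park_all[of "{}" p s] by auto
  then obtain v where v: "v \<in> {1..n}" "v \<notin> park_all p {} s" by blast
  have "card (below {1..n} p v) \<le> length (filter (\<lambda>x. x \<in> below {1..n} p v) s)"
    using le[OF v(1)] by (simp only: length_filter_mem_eq_sum finite_below)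
  also have "\<dots> = card (park_all p {} s \<inter> below {1..n} p v)"
    using park_all_below[OF maps s(2) _ v(2)] by simp
  also have "\<dots> < card (below {1..n} p v)"
    using v below_self[OF v(1)] by (intro psubset_card_mono finite_below) auto
  finally show False by simp
qed

lemma rooted_tree_iff:
  "rooted_tree n p \<longleftrightarrow> p \<in> {1..n} \<rightarrow>\<^sub>E {1..n} \<and>
     (\<exists>r\<in>{1..n}. p r = r \<and> (\<forall>v\<in>{1..n}. leads_to p r v))"
  by (simp add: rooted_tree_def leads_to_iff_funpow)

lemma rooted_tree_forest:
  assumes "rooted_tree n p"
  shows "finite_forest {1..n} p"
  using assms by unfold_locales (auto simp: rooted_tree_iff)

text \<open>Parking succeeds by \<open>park_succeeds\<close>: the strict inequalities cover the
  non-roots, and at the root both sides are n.\<close>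

lemma prime_parking_distribution_iff:
  "prime_parking_distribution n p s \<longleftrightarrow> rooted_tree n p \<and> length s = n \<and> set s \<subseteq> {1..n} \<and> sorted s \<and>
     (\<forall>v\<in>{1..n}. p v \<noteq> v \<longrightarrow>
        card (below {1..n} p v) < sum (count_list s) (below {1..n} p v))"
proof -
  have cnt: "card {i. i < n \<and> s ! i \<in> below {1..n} p v} = sum (count_list s) (below {1..n} p v)"
    if "length s = n" for v
    using that by (simp add: length_filter_conv_card below_def flip: length_filter_mem_eq_sum)
  have "park p {} s \<noteq> None"
    if T: "rooted_tree n p" and s: "length s = n" "set s \<subseteq> {1..n}"
      and lt: "\<forall>v\<in>{1..n}. p v \<noteq> v \<longrightarrow>
        card (below {1..n} p v) < sum (count_list s) (below {1..n} p v)"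
  proof (rule park_succeeds[OF rooted_tree_forest[OF T] s])
    fix v assume v: "v \<in> {1..n}"
    show "card (below {1..n} p v) \<le> sum (count_list s) (below {1..n} p v)"
    proof (cases "p v = v")
      case True
      obtain r where "\<And>u. u \<in> {1..n} \<Longrightarrow> leads_to p r u"
        using T unfolding rooted_tree_iff by blast
      moreover from this[OF v] True have "r = v" by (rule leads_to_fixed)
      ultimately have "below {1..n} p v = {1..n}" unfolding below_def by blast
      moreover have "sum (count_list s) {1..n} = n"
        using s by (simp add: filter_id_conv subset_iff flip: length_filter_mem_eq_sum)
      ultimately show ?thesis by simp
    qed (use lt v in auto)
  qed
  then show ?thesis
    using cnt unfolding prime_parking_distribution_def prime_parking_function_def
      parking_distribution_def parking_function_def subtree_eq_below by auto
qed

section \<open>The bijection with labelled trees of root excess 0\<close>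

text \<open>On prime parking distributions the subtraction is exact: the difference is positive at
  non-roots and 0 at the root.\<close>

definition excess :: "nat \<Rightarrow> (nat \<Rightarrow> nat) \<times> nat list \<Rightarrow> (nat \<Rightarrow> nat) \<times> (nat \<Rightarrow> nat)" where
  "excess n = (\<lambda>(p, s). (p, \<lambda>v\<in>{1..n}. sum (count_list s) (below {1..n} p v) - card (below {1..n} p v)))"

lemma excess_facts:
  assumes P: "prime_parking_distribution n p s" and e: "excess n (p, s) = (p, e)"
  shows "(p, e) \<in> trees {1..n} 0"
    and "\<And>v. v \<in> {1..n} \<Longrightarrow> Suc (e v) = count_list s v + sum e (children {1..n} p v)"
proof -
  from P have T: "rooted_tree n p" and s: "length s = n" "set s \<subseteq> {1..n}"
    and lt: "\<And>v. v \<in> {1..n} \<Longrightarrow> p v \<noteq> v \<Longrightarrow>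
        card (below {1..n} p v) < sum (count_list s) (below {1..n} p v)"
    by (auto simp: prime_parking_distribution_iff)
  interpret finite_forest "{1..n}" p using rooted_tree_forest[OF T] .
  from T obtain r where p: "p \<in> {1..n} \<rightarrow>\<^sub>E {1..n}"
    and r: "r \<in> {1..n}" "p r = r" "\<And>v. v \<in> {1..n} \<Longrightarrow> leads_to p r v"
    by (auto simp: rooted_tree_iff)
  have e_def: "e = (\<lambda>v\<in>{1..n}. sum (count_list s) (below {1..n} p v) - card (below {1..n} p v))"
    using e by (simp add: excess_def)
  have root: "v = r" if "v \<in> {1..n}" "p v = v" for v using leads_to_fixed r that by metis
  have "sum (count_list s) {1..n} = n"
    using s by (simp add: filter_id_conv subset_iff flip: length_filter_mem_eq_sum)
  moreover have below_r: "below {1..n} p r = {1..n}" using r by (auto simp: below_def)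
  ultimately have r_eq: "sum (count_list s) (below {1..n} p r) = card (below {1..n} p r)" by simp
  have "e v + card (below {1..n} p v) = sum (count_list s) (below {1..n} p v)" if "v \<in> {1..n}" for v
    using that lt[OF that] root[OF that] r_eq by (cases "p v = v") (auto simp: e_def)
  from excess_recursion[OF this]
  show rec: "Suc (e v) = count_list s v + sum e (children {1..n} p v)" if "v \<in> {1..n}" for v
    using that by blast
  have "1 \<le> e v" if "v \<in> {1..n}" "p v \<noteq> v" for v using lt[OF that] that by (simp add: e_def)
  moreover have "sum e (children {1..n} p v) \<le> Suc (e v)" if "v \<in> {1..n}" for v
    using rec[OF that] by simp
  moreover have "e \<in> extensional {1..n}" by (simp add: e_def)
  ultimately have "excess_forest {1..n} p e"
    unfolding excess_forest_def using p rooted by blast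
  moreover have "roots {1..n} p = {r}" using root r(1,2) unfolding roots_def by blast
  moreover have "e r = 0" using r_eq r by (simp add: e_def)
  ultimately show "(p, e) \<in> trees {1..n} 0" by (simp add: trees_def)
qed

text \<open>The local identity recovers how many drivers prefer each vertex, and a sorted list is
  determined by its multiplicities.\<close>

lemma excess_inj:
  "inj_on (excess n) {(p, s). prime_parking_distribution n p s}"
proof (rule inj_onI, clarify)
  fix p s q t
  assume P: "prime_parking_distribution n p s" and Q: "prime_parking_distribution n q t"
    and eq: "excess n (p, s) = excess n (q, t)"
  then have qp: "q = p" by (simp add: excess_def)
  obtain e where e: "excess n (p, s) = (p, e)" "excess n (p, t) = (p, e)"
    using eq qp by (simp add: excess_def)
  have "count_list s v = count_list t v" for v
  proof (cases "v \<in> {1..n}")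
    case True
    then show ?thesis using excess_facts(2)[OF P e(1)] excess_facts(2)[OF Q[unfolded qp] e(2)] by fastforce
  next
    case False
    then show ?thesis
      using P Q unfolding prime_parking_distribution_iff by (metis count_list_0_iff subsetD)
  qed
  then have "mset s = mset t" by (simp add: multiset_eq_iff count_mset)
  moreover have "sorted s" "sorted t" using P Q by (auto simp: prime_parking_distribution_iff)
  ultimately have "s = t" by (metis properties_for_sort)
  then show "p = q \<and> s = t" using qp by simp
qed

lemma exists_sorted_list_count:
  fixes a :: "nat \<Rightarrow> nat"
  assumes "finite V"
  obtains s where "sorted s" "set s \<subseteq> V" "\<And>v. v \<in> V \<Longrightarrow> count_list s v = a v"
proof -
  define M where "M = (\<Sum>v\<in>V. replicate_mset (a v) v)"
  have c: "count M v = (if v \<in> V then a v else 0)" for v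
    using assms by (simp add: M_def count_sum)
  show ?thesis
  proof
    show "sorted (sorted_list_of_multiset M)" by simp
    have "v \<in> V" if "v \<in># M" for v using that c[of v] by (metis count_greater_zero_iff less_irrefl)
    then show "set (sorted_list_of_multiset M) \<subseteq> V" by auto
    show "count_list (sorted_list_of_multiset M) v = a v" if "v \<in> V" for v
      using c[of v] that by (metis count_mset mset_sorted_list_of_multiset)
  qed
qed

lemma excess_surj:
  assumes t: "(p, e) \<in> trees {1..n} 0"
  shows "\<exists>s. prime_parking_distribution n p s \<and> excess n (p, s) = (p, e)"
proof -
  from t obtain r where F: "excess_forest {1..n} p e" and r: "roots {1..n} p = {r}" "e r = 0"
    by (auto simp: trees_def)
  interpret finite_forest "{1..n}" p
    using F by unfold_locales (auto simp: excess_forest_def)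
  have rin: "r \<in> {1..n}" "p r = r" using r by (auto simp: roots_def)
  have lead: "leads_to p r v" if "v \<in> {1..n}" for v
    using excess_forest_root[OF F that] r by auto
  have T: "rooted_tree n p"
    using F rin lead by (auto simp: rooted_tree_iff excess_forest_def)
  \<comment> \<open>These multiplicities are forced by the local identity; the bound in
    \<open>excess_forest\<close> makes the subtraction exact.\<close>
  obtain s where s: "sorted s" "set s \<subseteq> {1..n}"
    and c: "\<And>v. v \<in> {1..n} \<Longrightarrow> count_list s v = Suc (e v) - sum e (children {1..n} p v)"
    using exists_sorted_list_count[of "{1..n}" "\<lambda>v. Suc (e v) - sum e (children {1..n} p v)"] by auto
  have "Suc (e v) = count_list s v + sum e (children {1..n} p v)" if "v \<in> {1..n}" for v
    using c[OF that] F that by (simp add: excess_forest_def)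
  then have sums: "e v + card (below {1..n} p v) = sum (count_list s) (below {1..n} p v)"
    if "v \<in> {1..n}" for v
    using excess_sum that by blast
  have "below {1..n} p r = {1..n}" using lead by (auto simp: below_def)
  \<comment> \<open>The subtree of the root is all of [n] and e r = 0, so exactly n drivers are
    listed.\<close>
  then have "length s = n"
    using sums[OF rin(1)] r s by (simp add: filter_id_conv subset_iff flip: length_filter_mem_eq_sum)
  moreover have "card (below {1..n} p v) < sum (count_list s) (below {1..n} p v)"
    if "v \<in> {1..n}" "p v \<noteq> v" for v
  proof -
    have "1 \<le> e v" using F that unfolding excess_forest_def by blast
    then show ?thesis using sums[OF that(1)] by simp
  qed
  ultimately have "prime_parking_distribution n p s"
    using T s by (auto simp: prime_parking_distribution_iff)
  moreover have "(\<lambda>v\<in>{1..n}. sum (count_list s) (below {1..n} p v) - card (below {1..n} p v)) = e"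
  proof (rule extensionalityI[OF restrict_extensional])
    show "e \<in> extensional {1..n}" using F by (simp add: excess_forest_def)
    fix v assume "v \<in> {1..n}"
    then show "(\<lambda>v\<in>{1..n}. sum (count_list s) (below {1..n} p v) - card (below {1..n} p v)) v = e v"
      using sums[of v] by simp
  qed
  then have "excess n (p, s) = (p, e)" by (simp only: excess_def case_prod_conv)
  ultimately show ?thesis by blast
qed

theorem theorem1p5:
  fixes n :: nat
  assumes "n \<ge> 1"
  shows "card {(p, s). prime_parking_distribution n p s} = fact (n - 1) * schroeder (n - 1)"
proof -
  let ?P = "{(p, s). prime_parking_distribution n p s}"
  have "excess n ` ?P = trees {1..n} 0"
  proof (intro equalityI subsetI)
    fix t assume "t \<in> excess n ` ?P"
    then obtain p s where "prime_parking_distribution n p s" "t = excess n (p, s)" by auto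
    then show "t \<in> trees {1..n} 0"
      using excess_facts(1)[of n p s "snd t"] by (simp add: excess_def)
  next
    fix t assume "t \<in> trees {1..n} 0"
    then show "t \<in> excess n ` ?P" using excess_surj[of "fst t" "snd t" n] by force
  qed
  then have "card ?P = card (trees {1..n} 0)" using card_image[OF excess_inj] by metis
  also have "\<dots> = tree_count n 0" by (simp add: card_trees)
  also have "\<dots> = fact (n - 1) * schroeder (n - 1)"
    using tree_count_0[of "n - 1"] assms by simp
  finally show ?thesis .
qed

end
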